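(* Over $\mathrm{HA}^\omega+\mathrm{BI}+\mathrm{CONT}$ (with $R$ ranging over discrete types), the dependent iterated skewed product $\mathsf{MBR}$ and modified bar recursion $\mathsf{MBR}'$ are $T$-equivalent: $\mathsf{MBR}=_T\mathsf{MBR}'$, i.e. $\mathsf{MBR}\ge_T\mathsf{MBR}'$ and $\mathsf{MBR}'\ge_T\mathsf{MBR}$.
   Context: Types and systems. Finite types are generated from $\mathbb{B}$ (booleans) and $\mathbb{N}$ by $X\times Y$, $X\to Y$ and $X^*$ (finite sequences). For a sequence of types $(X_i)_{i\in\mathbb{N}}$, $\Pi_i X_i$ is the type of infinite sequences whose $i$-th entry is in $X_i$ and $\Pi_{i<n}X_i$ the type of finite sequences of length $n$. (This is used for readability; one may take all $X_i$ equal to one type $X$, reading $\Pi_iX_i$ as $\mathbb{N}\to X$ and finite sequence types as $X^*$.) $\mathrm{HA}^\omega$ is Heyting arithmetic in all finite types with fully extensional equality (Troelstra's E-$\mathrm{HA}^\omega$); system $T$ is its quantifier-free fragment (Gödel's primitive recursive functionals). Notation. $*$ is concatenation; $|s|$ is the length of $s$; $q_x(\alpha)=q(x*\alpha)$; $[\alpha](n)=\langle\alpha(0),\dots,\alpha(n-1)\rangle$. $T$-definability. A functional is specified by a defining equation (for each choice of type parameters). $G$ is $T$-definable from $F$ over a theory $\mathcal{S}$ (written $F\ge_T G$) if for each choice of types for $G$ there are a choice of types for $F$ and a term $s$ of system $T$ such that $s(F)$ satisfies the defining equation of $G$, provably in $\mathcal{S}$ together with the defining equation of $F$. In both definitions,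 $\varepsilon_s\colon(X_{|s|}\to R)\to\Pi_iX_{i+|s|}$ is a family indexed by finite sequences $s\colon\Pi_{i<|s|}X_i$. $\mathsf{MBR}$. For $q\colon\Pi_iX_{i+|s|}\to R$, $\mathsf{MBR}_s(\varepsilon)(q)\colon\Pi_iX_{i+|s|}$ is specified by $\mathsf{MBR}_s(\varepsilon)(q)=\varepsilon_s(\lambda x.\,q_x(\mathsf{MBR}_{s*x}(\varepsilon)(q_x)))$. $\mathsf{MBR}'$. For $q\colon\Pi_iX_i\to R$, $\mathsf{MBR}'_s(\varepsilon)(q)\colon\Pi_iX_i$ is specified by $\mathsf{MBR}'_s(\varepsilon)(q)=s*\varepsilon_s(\lambda x^{X_{|s|}}.\,q(\mathsf{MBR}'_{s*x}(\varepsilon)(q)))$. $\mathrm{CONT}$: for discrete $R$, $\forall q^{\Pi_iX_i\to R}\,\forall\alpha\,\exists n\,\forall\beta\,([\alpha](n)=[\beta](n)\to q(\alpha)=q(\beta))$. Discrete and compact types are generated by: compact $::=\mathbb{B}\mid$ compact $\times$ compact $\mid$ discrete $\to$ compact; discrete $::=\mathbb{B}\mid\mathbb{N}\mid$ discrete $\times$ discrete $\mid$ discrete$^*$ $\mid$ compact $\to$ discrete. $\mathrm{BI}$ (relativised bar induction) is the scheme, for arbitrary predicates $S,P$ on finite sequences: if $S(\langle\rangle)$, and for every infinite $\alpha$ with $S([\alpha](n))$ for all $n$ there is $n$ with $P([\alpha](n))$, and for all $s$ with $S(s)$: $\forall x[S(s*x)\to P(s*x)]\to P(s)$; then $P(\langle\rangle)$.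 *)

theory Defs
  imports Main
begin

section \<open>Finite types and system T\<close>

datatype ty =
    Bool
  | Nat
  | Prod ty ty
  | Fun ty ty  (infixr "\<rightarrow>" 60)
  | Seq ty

text \<open>The type of infinite sequences over \<open>X\<close>; all \<open>X\<^sub>i\<close> are taken equal to one type \<open>X\<close>,
  so that \<open>\<Pi>\<^sub>i X\<^sub>i\<close> and all its tails \<open>\<Pi>\<^sub>i X\<^sub>i\<^sub>+\<^sub>n\<close> become \<open>\<nat> \<rightarrow> X\<close>.\<close>
abbreviation Stream :: "ty \<Rightarrow> ty" where
  "Stream X \<equiv> Nat \<rightarrow> X"

text \<open>Finite sequences are generated by the empty sequence and by appending one entry at the
  \<^emph>\<open>right\<close> end, so that the constructor \<open>Snoc\<close> is the operation \<open>s * x\<close>.\<close>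
datatype con =
    TT | FF | Cond ty
  | Zero | Succ | NRec ty
  | MkPair ty ty | Proj1 ty ty | Proj2 ty ty
  | Empty ty | Snoc ty | SRec ty ty

primrec con_type :: "con \<Rightarrow> ty" where
  "con_type TT = Bool"
| "con_type FF = Bool"
| "con_type (Cond \<tau>) = Bool \<rightarrow> \<tau> \<rightarrow> \<tau> \<rightarrow> \<tau>"
| "con_type Zero = Nat"
| "con_type Succ = Nat \<rightarrow> Nat"
| "con_type (NRec \<tau>) = \<tau> \<rightarrow> (Nat \<rightarrow> \<tau> \<rightarrow> \<tau>) \<rightarrow> Nat \<rightarrow> \<tau>"
| "con_type (MkPair \<sigma> \<tau>) = \<sigma> \<rightarrow> \<tau> \<rightarrow> Prod \<sigma> \<tau>"
| "con_type (Proj1 \<sigma> \<tau>) = Prod \<sigma> \<tau> \<rightarrow> \<sigma>"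
| "con_type (Proj2 \<sigma> \<tau>) = Prod \<sigma> \<tau> \<rightarrow> \<tau>"
| "con_type (Empty X) = Seq X"
| "con_type (Snoc X) = Seq X \<rightarrow> X \<rightarrow> Seq X"
| "con_type (SRec X \<tau>) = \<tau> \<rightarrow> (Seq X \<rightarrow> X \<rightarrow> \<tau> \<rightarrow> \<tau>) \<rightarrow> Seq X \<rightarrow> \<tau>"

text \<open>Variables are de Bruijn indices; a context lists the types of the indices \<open>0, 1, \<dots>\<close>.
  Terms and formulas use the same indices.\<close>
datatype tm =
    Var nat
  | Con con
  | App tm tm  (infixl "\<cdot>" 100)
  | Lam ty tm

inductive has_type :: "ty list \<Rightarrow> tm \<Rightarrow> ty \<Rightarrow> bool"  ("_ \<turnstile> _ \<Colon> _" [50, 50, 50] 50) where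
  Var: "i < length \<Gamma> \<Longrightarrow> \<Gamma> \<turnstile> Var i \<Colon> \<Gamma> ! i"
| Con: "\<Gamma> \<turnstile> Con c \<Colon> con_type c"
| App: "\<Gamma> \<turnstile> t \<Colon> \<sigma> \<rightarrow> \<tau> \<Longrightarrow> \<Gamma> \<turnstile> u \<Colon> \<sigma> \<Longrightarrow> \<Gamma> \<turnstile> t \<cdot> u \<Colon> \<tau>"
| Lam: "\<sigma> # \<Gamma> \<turnstile> t \<Colon> \<tau> \<Longrightarrow> \<Gamma> \<turnstile> Lam \<sigma> t \<Colon> \<sigma> \<rightarrow> \<tau>"

primrec ren :: "(nat \<Rightarrow> nat) \<Rightarrow> tm \<Rightarrow> tm" where
  "ren \<rho> (Var i) = Var (\<rho> i)"
| "ren \<rho> (Con c) = Con c"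
| "ren \<rho> (t \<cdot> u) = ren \<rho> t \<cdot> ren \<rho> u"
| "ren \<rho> (Lam \<sigma> t) = Lam \<sigma> (ren (case_nat 0 (\<lambda>i. Suc (\<rho> i))) t)"

definition up :: "(nat \<Rightarrow> tm) \<Rightarrow> nat \<Rightarrow> tm" where
  "up \<theta> = case_nat (Var 0) (\<lambda>i. ren Suc (\<theta> i))"

primrec sub :: "(nat \<Rightarrow> tm) \<Rightarrow> tm \<Rightarrow> tm" where
  "sub \<theta> (Var i) = \<theta> i"
| "sub \<theta> (Con c) = Con c"
| "sub \<theta> (t \<cdot> u) = sub \<theta> t \<cdot> sub \<theta> u"
| "sub \<theta> (Lam \<sigma> t) = Lam \<sigma> (sub (up \<theta>) t)"

text \<open>\<open>\<lambda>x \<alpha>. x * \<alpha>\<close>, that is, \<open>(x * \<alpha>)(0) = x\<close> and \<open>(x * \<alpha>)(n + 1) = \<alpha>(n)\<close>.\<close>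
definition cons_tm :: "ty \<Rightarrow> tm" where
  "cons_tm X = Lam X (Lam (Stream X) (Lam Nat
     (Con (NRec X) \<cdot> Var 2 \<cdot> Lam Nat (Lam X (Var 3 \<cdot> Var 1)) \<cdot> Var 0)))"

text \<open>\<open>\<lambda>s \<alpha>. s * \<alpha>\<close>, by recursion on \<open>s\<close>: \<open>\<langle>\<rangle> * \<alpha> = \<alpha>\<close> and \<open>(s * x) * \<alpha> = s * (x * \<alpha>)\<close>.\<close>
definition append_tm :: "ty \<Rightarrow> tm" where
  "append_tm X = Con (SRec X (Stream X \<rightarrow> Stream X))
     \<cdot> Lam (Stream X) (Var 0)
     \<cdot> Lam (Seq X) (Lam X (Lam (Stream X \<rightarrow> Stream X) (Lam (Stream X)
         (Var 1 \<cdot> (cons_tm X \<cdot> Var 2 \<cdot> Var 0)))))"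

text \<open>\<open>\<lambda>\<alpha> n. [\<alpha>](n)\<close>, by recursion on \<open>n\<close>: \<open>[\<alpha>](0) = \<langle>\<rangle>\<close> and \<open>[\<alpha>](n + 1) = [\<alpha>](n) * \<alpha>(n)\<close>.\<close>
definition prefix_tm :: "ty \<Rightarrow> tm" where
  "prefix_tm X = Lam (Stream X) (Lam Nat
     (Con (NRec (Seq X)) \<cdot> Con (Empty X)
        \<cdot> Lam Nat (Lam (Seq X) (Con (Snoc X) \<cdot> Var 0 \<cdot> (Var 3 \<cdot> Var 1))) \<cdot> Var 0))"

text \<open>\<open>\<lambda>q x. q\<^sub>x\<close>, where \<open>q\<^sub>x(\<alpha>) = q(x * \<alpha>)\<close>.\<close>
definition section_tm :: "ty \<Rightarrow> ty \<Rightarrow> tm" where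
  "section_tm X R = Lam (Stream X \<rightarrow> R) (Lam X (Lam (Stream X)
     (Var 2 \<cdot> (cons_tm X \<cdot> Var 1 \<cdot> Var 0))))"

inductive compact_type :: "ty \<Rightarrow> bool" and discrete_type :: "ty \<Rightarrow> bool" where
  "compact_type Bool"
| "compact_type \<sigma> \<Longrightarrow> compact_type \<tau> \<Longrightarrow> compact_type (Prod \<sigma> \<tau>)"
| "discrete_type \<sigma> \<Longrightarrow> compact_type \<tau> \<Longrightarrow> compact_type (\<sigma> \<rightarrow> \<tau>)"
| "discrete_type Bool"
| "discrete_type Nat"
| "discrete_type \<sigma> \<Longrightarrow> discrete_type \<tau> \<Longrightarrow> discrete_type (Prod \<sigma> \<tau>)"
| "discrete_type \<sigma> \<Longrightarrow> discrete_type (Seq \<sigma>)"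
| "compact_type \<sigma> \<Longrightarrow> discrete_type \<tau> \<Longrightarrow> discrete_type (\<sigma> \<rightarrow> \<tau>)"


section \<open>Formulas and intuitionistic derivability\<close>

datatype fm =
    Eq ty tm tm
  | Fls
  | Conj fm fm
  | Disj fm fm
  | Imp fm fm  (infixr "\<^bold>\<longrightarrow>" 25)
  | All ty fm
  | Ex ty fm

primrec wff :: "ty list \<Rightarrow> fm \<Rightarrow> bool" where
  "wff \<Gamma> (Eq \<tau> t u) \<longleftrightarrow> \<Gamma> \<turnstile> t \<Colon> \<tau> \<and> \<Gamma> \<turnstile> u \<Colon> \<tau>"
| "wff \<Gamma> Fls \<longleftrightarrow> True"
| "wff \<Gamma> (Conj A B) \<longleftrightarrow> wff \<Gamma> A \<and> wff \<Gamma> B"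
| "wff \<Gamma> (Disj A B) \<longleftrightarrow> wff \<Gamma> A \<and> wff \<Gamma> B"
| "wff \<Gamma> (A \<^bold>\<longrightarrow> B) \<longleftrightarrow> wff \<Gamma> A \<and> wff \<Gamma> B"
| "wff \<Gamma> (All \<tau> A) \<longleftrightarrow> wff (\<tau> # \<Gamma>) A"
| "wff \<Gamma> (Ex \<tau> A) \<longleftrightarrow> wff (\<tau> # \<Gamma>) A"

primrec fsub :: "(nat \<Rightarrow> tm) \<Rightarrow> fm \<Rightarrow> fm" where
  "fsub \<theta> (Eq \<tau> t u) = Eq \<tau> (sub \<theta> t) (sub \<theta> u)"
| "fsub \<theta> Fls = Fls"
| "fsub \<theta> (Conj A B) = Conj (fsub \<theta> A) (fsub \<theta> B)"
| "fsub \<theta> (Disj A B) = Disj (fsub \<theta> A) (fsub \<theta> B)"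
| "fsub \<theta> (A \<^bold>\<longrightarrow> B) = (fsub \<theta> A \<^bold>\<longrightarrow> fsub \<theta> B)"
| "fsub \<theta> (All \<tau> A) = All \<tau> (fsub (up \<theta>) A)"
| "fsub \<theta> (Ex \<tau> A) = Ex \<tau> (fsub (up \<theta>) A)"

text \<open>If \<open>A\<close> lives in the context \<open>\<tau> # \<Gamma>\<close> and \<open>t\<close> has type \<open>\<tau>\<close> in \<open>\<Delta> @ \<Gamma>\<close> with
  \<open>length \<Delta> = k\<close>, then \<open>inst k t A\<close> is \<open>A(t)\<close> as a formula in the context \<open>\<Delta> @ \<Gamma>\<close>.
  So \<open>inst 0 t A\<close> is ordinary instantiation, and \<open>k\<close> counts the quantifiers under which the
  instance is placed.\<close>
definition inst :: "nat \<Rightarrow> tm \<Rightarrow> fm \<Rightarrow> fm" where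
  "inst k t A = fsub (case_nat t (\<lambda>i. Var (k + i))) A"

abbreviation lift :: "fm \<Rightarrow> fm" where
  "lift \<equiv> fsub (\<lambda>i. Var (Suc i))"

text \<open>A theory is given by its axioms, each a formula in a context (the free variables of an axiom
  are parameters). Natural deduction: \<open>derivable S \<Gamma> H A\<close> says that \<open>A\<close> follows in \<open>S\<close> from the
  hypotheses \<open>H\<close>, with free variables typed by \<open>\<Gamma>\<close>. The rules admit only well-formed axioms and
  hypotheses, so that axiom schemes need no typing conditions of their own.\<close>
type_synonym axiom_system = "(ty list \<times> fm) set"

inductive derivable :: "axiom_system \<Rightarrow> ty list \<Rightarrow> fm set \<Rightarrow> fm \<Rightarrow> bool"
  for S :: axiom_system where
  ax: "(\<Gamma>, A) \<in> S \<Longrightarrow> wff \<Gamma> A \<Longrightarrow> derivable S \<Gamma> H A"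
| hyp: "A \<in> H \<Longrightarrow> wff \<Gamma> A \<Longrightarrow> derivable S \<Gamma> H A"
| flsE: "derivable S \<Gamma> H Fls \<Longrightarrow> wff \<Gamma> A \<Longrightarrow> derivable S \<Gamma> H A"
| conjI: "derivable S \<Gamma> H A \<Longrightarrow> derivable S \<Gamma> H B \<Longrightarrow> derivable S \<Gamma> H (Conj A B)"
| conjE1: "derivable S \<Gamma> H (Conj A B) \<Longrightarrow> derivable S \<Gamma> H A"
| conjE2: "derivable S \<Gamma> H (Conj A B) \<Longrightarrow> derivable S \<Gamma> H B"
| disjI1: "derivable S \<Gamma> H A \<Longrightarrow> wff \<Gamma> B \<Longrightarrow> derivable S \<Gamma> H (Disj A B)"
| disjI2: "derivable S \<Gamma> H B \<Longrightarrow> wff \<Gamma> A \<Longrightarrow> derivable S \<Gamma> H (Disj A B)"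
| disjE: "derivable S \<Gamma> H (Disj A B) \<Longrightarrow> derivable S \<Gamma> (insert A H) C \<Longrightarrow>
    derivable S \<Gamma> (insert B H) C \<Longrightarrow> derivable S \<Gamma> H C"
| impI: "wff \<Gamma> A \<Longrightarrow> derivable S \<Gamma> (insert A H) B \<Longrightarrow> derivable S \<Gamma> H (A \<^bold>\<longrightarrow> B)"
| impE: "derivable S \<Gamma> H (A \<^bold>\<longrightarrow> B) \<Longrightarrow> derivable S \<Gamma> H A \<Longrightarrow> derivable S \<Gamma> H B"
| allI: "derivable S (\<tau> # \<Gamma>) (lift ` H) A \<Longrightarrow> derivable S \<Gamma> H (All \<tau> A)"
| allE: "derivable S \<Gamma> H (All \<tau> A) \<Longrightarrow> \<Gamma> \<turnstile> t \<Colon> \<tau> \<Longrightarrow> derivable S \<Gamma> H (inst 0 t A)"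
| exI: "wff (\<tau> # \<Gamma>) A \<Longrightarrow> \<Gamma> \<turnstile> t \<Colon> \<tau> \<Longrightarrow> derivable S \<Gamma> H (inst 0 t A) \<Longrightarrow>
    derivable S \<Gamma> H (Ex \<tau> A)"
| exE: "derivable S \<Gamma> H (Ex \<tau> A) \<Longrightarrow>
    derivable S (\<tau> # \<Gamma>) (insert A (lift ` H)) (lift C) \<Longrightarrow> derivable S \<Gamma> H C"


section \<open>The axioms\<close>

text \<open>Heyting arithmetic in all finite types with extensional equality. The eta rule, the
  compatibility of equality with abstraction, and symmetry and transitivity follow from
  \<open>ext\<close>, \<open>beta\<close>, \<open>refl\<close> and \<open>leibniz\<close>.\<close>
inductive_set HA_omega :: axiom_system where
  refl: "(\<Gamma>, Eq \<tau> t t) \<in> HA_omega"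
| leibniz: "(\<Gamma>, Eq \<tau> t u \<^bold>\<longrightarrow> inst 0 t A \<^bold>\<longrightarrow> inst 0 u A) \<in> HA_omega"
| ext: "(\<Gamma>, All (\<sigma> \<rightarrow> \<tau>) (All (\<sigma> \<rightarrow> \<tau>)
      (All \<sigma> (Eq \<tau> (Var 2 \<cdot> Var 0) (Var 1 \<cdot> Var 0)) \<^bold>\<longrightarrow> Eq (\<sigma> \<rightarrow> \<tau>) (Var 1) (Var 0)))) \<in> HA_omega"
| beta: "(\<Gamma>, Eq \<tau> (Lam \<sigma> t \<cdot> u) (sub (case_nat u Var) t)) \<in> HA_omega"
| cond_TT: "(\<Gamma>, Eq \<tau> (Con (Cond \<tau>) \<cdot> Con TT \<cdot> a \<cdot> b) a) \<in> HA_omega"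
| cond_FF: "(\<Gamma>, Eq \<tau> (Con (Cond \<tau>) \<cdot> Con FF \<cdot> a \<cdot> b) b) \<in> HA_omega"
| bool_cases: "(\<Gamma>, inst 0 (Con TT) A \<^bold>\<longrightarrow> inst 0 (Con FF) A \<^bold>\<longrightarrow> All Bool A) \<in> HA_omega"
| nrec_Zero: "(\<Gamma>, Eq \<tau> (Con (NRec \<tau>) \<cdot> a \<cdot> f \<cdot> Con Zero) a) \<in> HA_omega"
| nrec_Succ: "(\<Gamma>, Eq \<tau> (Con (NRec \<tau>) \<cdot> a \<cdot> f \<cdot> (Con Succ \<cdot> n))
      (f \<cdot> n \<cdot> (Con (NRec \<tau>) \<cdot> a \<cdot> f \<cdot> n))) \<in> HA_omega"
| Succ_neq_Zero: "(\<Gamma>, Eq Nat (Con Succ \<cdot> n) (Con Zero) \<^bold>\<longrightarrow> Fls) \<in> HA_omega"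
| Succ_inject: "(\<Gamma>, Eq Nat (Con Succ \<cdot> m) (Con Succ \<cdot> n) \<^bold>\<longrightarrow> Eq Nat m n) \<in> HA_omega"
| nat_induct: "(\<Gamma>, inst 0 (Con Zero) A \<^bold>\<longrightarrow> All Nat (A \<^bold>\<longrightarrow> inst 1 (Con Succ \<cdot> Var 0) A) \<^bold>\<longrightarrow>
      All Nat A) \<in> HA_omega"
| proj1: "(\<Gamma>, Eq \<sigma> (Con (Proj1 \<sigma> \<tau>) \<cdot> (Con (MkPair \<sigma> \<tau>) \<cdot> a \<cdot> b)) a) \<in> HA_omega"
| proj2: "(\<Gamma>, Eq \<tau> (Con (Proj2 \<sigma> \<tau>) \<cdot> (Con (MkPair \<sigma> \<tau>) \<cdot> a \<cdot> b)) b) \<in> HA_omega"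
| pair: "(\<Gamma>, Eq (Prod \<sigma> \<tau>)
      (Con (MkPair \<sigma> \<tau>) \<cdot> (Con (Proj1 \<sigma> \<tau>) \<cdot> c) \<cdot> (Con (Proj2 \<sigma> \<tau>) \<cdot> c)) c) \<in> HA_omega"
| srec_Empty: "(\<Gamma>, Eq \<tau> (Con (SRec X \<tau>) \<cdot> a \<cdot> f \<cdot> Con (Empty X)) a) \<in> HA_omega"
| srec_Snoc: "(\<Gamma>, Eq \<tau> (Con (SRec X \<tau>) \<cdot> a \<cdot> f \<cdot> (Con (Snoc X) \<cdot> s \<cdot> x))
      (f \<cdot> s \<cdot> x \<cdot> (Con (SRec X \<tau>) \<cdot> a \<cdot> f \<cdot> s))) \<in> HA_omega"
| seq_induct: "(\<Gamma>, inst 0 (Con (Empty X)) A \<^bold>\<longrightarrow>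
      All (Seq X) (A \<^bold>\<longrightarrow> All X (inst 2 (Con (Snoc X) \<cdot> Var 1 \<cdot> Var 0) A)) \<^bold>\<longrightarrow>
      All (Seq X) A) \<in> HA_omega"

text \<open>Relativised bar induction for predicates \<open>P\<close> and \<open>Q\<close> (formulas in which index 0 is the
  finite sequence), with \<open>P\<close> the relativising one.\<close>
definition bi_fm :: "ty \<Rightarrow> fm \<Rightarrow> fm \<Rightarrow> fm" where
  "bi_fm X P Q =
     (inst 0 (Con (Empty X)) P \<^bold>\<longrightarrow>
      All (Stream X) (All Nat (inst 2 (prefix_tm X \<cdot> Var 1 \<cdot> Var 0) P) \<^bold>\<longrightarrow>
                      Ex Nat (inst 2 (prefix_tm X \<cdot> Var 1 \<cdot> Var 0) Q)) \<^bold>\<longrightarrow>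
      All (Seq X) (P \<^bold>\<longrightarrow>
                   All X (inst 2 (Con (Snoc X) \<cdot> Var 1 \<cdot> Var 0) P \<^bold>\<longrightarrow>
                          inst 2 (Con (Snoc X) \<cdot> Var 1 \<cdot> Var 0) Q) \<^bold>\<longrightarrow>
                   Q) \<^bold>\<longrightarrow>
      inst 0 (Con (Empty X)) Q)"

definition BI :: axiom_system where
  "BI = {(\<Gamma>, bi_fm X P Q) | \<Gamma> X P Q. True}"

text \<open>\<open>\<forall>q \<alpha>. \<exists>n. \<forall>\<beta>. [\<alpha>](n) = [\<beta>](n) \<longrightarrow> q(\<alpha>) = q(\<beta>)\<close>.\<close>
definition cont_fm :: "ty \<Rightarrow> ty \<Rightarrow> fm" where
  "cont_fm X R = All (Stream X \<rightarrow> R) (All (Stream X) (Ex Nat (All (Stream X)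
     (Eq (Seq X) (prefix_tm X \<cdot> Var 2 \<cdot> Var 1) (prefix_tm X \<cdot> Var 0 \<cdot> Var 1) \<^bold>\<longrightarrow>
      Eq R (Var 3 \<cdot> Var 2) (Var 3 \<cdot> Var 0)))))"

definition CONT :: axiom_system where
  "CONT = {(\<Gamma>, cont_fm X R) | \<Gamma> X R. discrete_type R}"


section \<open>Functionals and T-definability\<close>

text \<open>A functional is specified, for each admissible choice of type parameters, by its type and its
  defining equation, a formula whose only free variable 0 stands for the functional.\<close>
record 'p functional =
  choices :: "'p set"
  fun_type :: "'p \<Rightarrow> ty"
  def_eq :: "'p \<Rightarrow> fm"

text \<open>\<open>T_defines S F G\<close> is \<open>F \<ge>\<^sub>T G\<close> over \<open>S\<close>: \<open>G\<close> is \<open>T\<close>-definable from \<open>F\<close>.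
  The functional \<open>F\<close> is a fresh parameter, so it may occur in instances of the axiom schemes of \<open>S\<close>.\<close>
definition T_defines :: "axiom_system \<Rightarrow> 'p functional \<Rightarrow> 'q functional \<Rightarrow> bool" where
  "T_defines S F G \<longleftrightarrow>
     (\<forall>g \<in> choices G. \<exists>f \<in> choices F. \<exists>s.
        [] \<turnstile> s \<Colon> fun_type F f \<rightarrow> fun_type G g \<and>
        derivable S [fun_type F f] {def_eq F f} (inst 1 (s \<cdot> Var 0) (def_eq G g)))"

text \<open>The argument order is \<open>s\<close>, \<open>\<epsilon>\<close>, \<open>q\<close>. Type parameters are pairs \<open>(X, R)\<close>.\<close>
definition bar_rec_type :: "ty \<times> ty \<Rightarrow> ty" where
  "bar_rec_type = (\<lambda>(X, R).
     Seq X \<rightarrow> (Seq X \<rightarrow> (X \<rightarrow> R) \<rightarrow> Stream X) \<rightarrow> (Stream X \<rightarrow> R) \<rightarrow> Stream X)"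

text \<open>\<open>\<forall>s \<epsilon> q. F\<^sub>s(\<epsilon>)(q) = \<epsilon>\<^sub>s(\<lambda>x. q\<^sub>x(F\<^sub>s\<^sub>*\<^sub>x(\<epsilon>)(q\<^sub>x)))\<close>\<close>
definition MBR_eq :: "ty \<times> ty \<Rightarrow> fm" where
  "MBR_eq = (\<lambda>(X, R).
     All (Seq X) (All (Seq X \<rightarrow> (X \<rightarrow> R) \<rightarrow> Stream X) (All (Stream X \<rightarrow> R)
       (Eq (Stream X)
          (Var 3 \<cdot> Var 2 \<cdot> Var 1 \<cdot> Var 0)
          (Var 1 \<cdot> Var 2 \<cdot> Lam X
             ((section_tm X R \<cdot> Var 1 \<cdot> Var 0)
              \<cdot> (Var 4 \<cdot> (Con (Snoc X) \<cdot> Var 3 \<cdot> Var 0) \<cdot> Var 2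
                   \<cdot> (section_tm X R \<cdot> Var 1 \<cdot> Var 0))))))))"

text \<open>\<open>\<forall>s \<epsilon> q. F\<^sub>s(\<epsilon>)(q) = s * \<epsilon>\<^sub>s(\<lambda>x. q(F\<^sub>s\<^sub>*\<^sub>x(\<epsilon>)(q)))\<close>\<close>
definition MBR'_eq :: "ty \<times> ty \<Rightarrow> fm" where
  "MBR'_eq = (\<lambda>(X, R).
     All (Seq X) (All (Seq X \<rightarrow> (X \<rightarrow> R) \<rightarrow> Stream X) (All (Stream X \<rightarrow> R)
       (Eq (Stream X)
          (Var 3 \<cdot> Var 2 \<cdot> Var 1 \<cdot> Var 0)
          (append_tm X \<cdot> Var 2 \<cdot> (Var 1 \<cdot> Var 2 \<cdot> Lam X
             (Var 1 \<cdot> (Var 4 \<cdot> (Con (Snoc X) \<cdot> Var 3 \<cdot> Var 0) \<cdot> Var 2 \<cdot> Var 1))))))))"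

definition MBR :: "(ty \<times> ty) functional" where
  "MBR = \<lparr>choices = {(X, R). discrete_type R}, fun_type = bar_rec_type, def_eq = MBR_eq\<rparr>"

definition MBR' :: "(ty \<times> ty) functional" where
  "MBR' = \<lparr>choices = {(X, R). discrete_type R}, fun_type = bar_rec_type, def_eq = MBR'_eq\<rparr>"

end

theory Submission
  imports Defs
begin

text \<open>If \<open>F\<close> satisfies the equation of \<open>MBR\<close>, then \<open>s * F\<^sub>s(\<epsilon>)(q\<^sub>s)\<close> with \<open>q\<^sub>s(\<alpha>) = q(s * \<alpha>)\<close>
  satisfies that of \<open>MBR'\<close>, because \<open>(q\<^sub>s)\<^sub>x = q\<^sub>s\<^sub>*\<^sub>x\<close>; neither \<open>BI\<close> nor \<open>CONT\<close> is used.

  Conversely, if \<open>G\<close> satisfies the equation of \<open>MBR'\<close>, put \<open>F\<^sub>s(\<epsilon>)(q) = G\<^sub>\<langle>\<^sub>\<rangle>(\<epsilon>\<^sup>s)(q)\<close> where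
  \<open>\<epsilon>\<^sup>s\<close> at \<open>u\<close> is \<open>\<epsilon>\<^sub>s\<^sub>*\<^sub>u\<close>. The equation of \<open>MBR\<close> then amounts to
  \<open>G\<^sub>x(\<epsilon>\<^sup>s)(q) = x * G\<^sub>\<langle>\<^sub>\<rangle>(\<epsilon>\<^sup>s\<^sup>*\<^sup>x)(q\<^sub>x)\<close>. More generally
  \<open>G\<^sub>x\<^sub>*\<^sub>u(\<epsilon>\<^sup>s)(q) = x * G\<^sub>u(\<epsilon>\<^sup>s\<^sup>*\<^sup>x)(q\<^sub>x)\<close> follows by bar induction on \<open>u\<close>: both sides unfold to
  \<open>x * u * \<epsilon>\<^sub>s\<^sub>*\<^sub>x\<^sub>*\<^sub>u(\<dots>)\<close>, and as soon as \<open>q\<^sub>x\<close> is constant on the extensions of \<open>u\<close>, both functions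
  to which \<open>\<epsilon>\<^sub>s\<^sub>*\<^sub>x\<^sub>*\<^sub>u\<close> is applied are constant with the same value.\<close>

section \<open>Typing and substitution\<close>

text \<open>A term has at most one type, so typing can be computed by a partial function that the
  simplifier runs on concrete terms; \<open>has_type_iff\<close> links it to the typing
  relation.\<close>

fun tyapp :: "ty option \<Rightarrow> ty option \<Rightarrow> ty option" where
  "tyapp (Some (\<sigma> \<rightarrow> \<tau>)) b = (if b = Some \<sigma> then Some \<tau> else None)"
| "tyapp _ _ = None"

primrec tyof :: "ty list \<Rightarrow> tm \<Rightarrow> ty option" where
  "tyof \<Gamma> (Var i) = (if i < length \<Gamma> then Some (\<Gamma> ! i) else None)"
| "tyof \<Gamma> (Con c) = Some (con_type c)"
| "tyof \<Gamma> (t \<cdot> u) = tyapp (tyof \<Gamma> t) (tyof \<Gamma> u)"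
| "tyof \<Gamma> (Lam \<sigma> t) = map_option (Fun \<sigma>) (tyof (\<sigma> # \<Gamma>) t)"

lemma tyapp_eq_Some: "tyapp a b = Some \<tau> \<longleftrightarrow> (\<exists>\<sigma>. a = Some (\<sigma> \<rightarrow> \<tau>) \<and> b = Some \<sigma>)"
  by (induction a b rule: tyapp.induct) auto

lemma tyapp_None [simp]: "tyapp a None = None"
  by (metis not_Some_eq option.distinct(1) tyapp_eq_Some)

lemma has_type_iff: "\<Gamma> \<turnstile> t \<Colon> \<tau> \<longleftrightarrow> tyof \<Gamma> t = Some \<tau>"
proof
  show "\<Gamma> \<turnstile> t \<Colon> \<tau> \<Longrightarrow> tyof \<Gamma> t = Some \<tau>"
    by (induction rule: has_type.induct) auto
  show "tyof \<Gamma> t = Some \<tau> \<Longrightarrow> \<Gamma> \<turnstile> t \<Colon> \<tau>"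
  proof (induction t arbitrary: \<Gamma> \<tau>)
    case (App t u)
    then show ?case by (metis has_type.App tyapp_eq_Some tyof.simps(3))
  qed (auto intro: has_type.intros split: if_splits)
qed

text \<open>The biconditional keeps out-of-range variables out of range, so untypable terms stay
  untypable and the result is an equation between options, fit for rewriting.\<close>

lemma tyof_ren:
  assumes "\<And>i. \<rho> i < length \<Delta> \<longleftrightarrow> i < length \<Gamma>" "\<And>i. i < length \<Gamma> \<Longrightarrow> \<Delta> ! \<rho> i = \<Gamma> ! i"
  shows "tyof \<Delta> (ren \<rho> t) = tyof \<Gamma> t"
  using assms
proof (induction t arbitrary: \<rho> \<Gamma> \<Delta>)
  case (Lam \<sigma> t)
  have "tyof (\<sigma> # \<Delta>) (ren (case_nat 0 (\<lambda>i. Suc (\<rho> i))) t) = tyof (\<sigma> # \<Gamma>) t"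
    by (rule Lam.IH) (auto simp: Lam.prems split: nat.split)
  then show ?case by simp
next
  case (App t u)
  from App.IH[OF App.prems] show ?case by simp
qed auto

lemma tyof_ren_Suc [simp]: "tyof (\<sigma> # \<Gamma>) (ren Suc t) = tyof \<Gamma> t"
  by (rule tyof_ren) auto

lemma tyof_sub:
  assumes "tyof \<Gamma> t = Some \<tau>" "\<And>i. i < length \<Gamma> \<Longrightarrow> tyof \<Delta> (\<theta> i) = Some (\<Gamma> ! i)"
  shows "tyof \<Delta> (sub \<theta> t) = Some \<tau>"
  using assms
proof (induction t arbitrary: \<theta> \<Gamma> \<Delta> \<tau>)
  case (Lam \<sigma> t)
  then obtain \<tau>' where t: "tyof (\<sigma> # \<Gamma>) t = Some \<tau>'" "\<tau> = \<sigma> \<rightarrow> \<tau>'" by auto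
  have "tyof (\<sigma> # \<Delta>) (sub (up \<theta>) t) = Some \<tau>'"
    by (rule Lam.IH[OF t(1)]) (auto simp: Lam.prems up_def split: nat.split)
  then show ?case using t by simp
next
  case (App t u)
  then show ?case by (fastforce simp: tyapp_eq_Some)
qed (auto split: if_splits)

section \<open>Composition laws of renaming and substitution\<close>

lemma ren_ren: "ren \<rho> (ren \<rho>' t) = ren (\<lambda>i. \<rho> (\<rho>' i)) t"
proof (induction t arbitrary: \<rho> \<rho>')
  case (Lam \<sigma> t)
  have "(\<lambda>i. case_nat 0 (\<lambda>i. Suc (\<rho> i)) (case_nat 0 (\<lambda>i. Suc (\<rho>' i)) i))
      = case_nat 0 (\<lambda>i. Suc (\<rho> (\<rho>' i)))"
    by (auto split: nat.split)
  then show ?case by (simp add: Lam)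
qed auto

lemma sub_ren: "sub \<theta> (ren \<rho> t) = sub (\<lambda>i. \<theta> (\<rho> i)) t"
proof (induction t arbitrary: \<rho> \<theta>)
  case (Lam \<sigma> t)
  have "(\<lambda>i. up \<theta> (case_nat 0 (\<lambda>i. Suc (\<rho> i)) i)) = up (\<lambda>i. \<theta> (\<rho> i))"
    by (auto simp: up_def split: nat.split)
  then show ?case by (simp add: Lam)
qed auto

lemma ren_sub: "ren \<rho> (sub \<theta> t) = sub (\<lambda>i. ren \<rho> (\<theta> i)) t"
proof (induction t arbitrary: \<rho> \<theta>)
  case (Lam \<sigma> t)
  have "(\<lambda>i. ren (case_nat 0 (\<lambda>i. Suc (\<rho> i))) (up \<theta> i)) = up (\<lambda>i. ren \<rho> (\<theta> i))"
    by (auto simp: up_def ren_ren split: nat.split)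
  then show ?case by (simp add: Lam)
qed auto

lemma sub_Var_comp: "sub (\<lambda>i. Var (\<rho> i)) t = ren \<rho> t"
proof (induction t arbitrary: \<rho>)
  case (Lam \<sigma> t)
  have "up (\<lambda>i. Var (\<rho> i)) = (\<lambda>i. Var (case_nat 0 (\<lambda>i. Suc (\<rho> i)) i))"
    by (auto simp: up_def split: nat.split)
  then show ?case by (simp add: Lam)
qed auto

lemma up_Var [simp]: "up Var = Var"
  by (auto simp: up_def split: nat.split)

lemma sub_Var [simp]: "sub Var t = t"
  by (induction t) auto

lemma sub_Var_Suc [simp]: "sub (\<lambda>i. Var (Suc i)) t = ren Suc t"
  by (rule sub_Var_comp)

lemma sub_Var_Suc_Suc [simp]: "sub (\<lambda>i. Var (Suc (Suc i))) t = ren Suc (ren Suc t)"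
  by (simp add: sub_Var_comp ren_ren)

text \<open>This rule and the next two cancel a weakening or move it outwards; with them
  \<open>inst\<close> evaluates on terms of the form \<open>ren Suc t\<close>.\<close>

lemma sub_case_nat_ren_Suc [simp]: "sub (case_nat u \<theta>) (ren Suc t) = sub \<theta> t"
  by (simp add: sub_ren)

lemma sub_up_ren_Suc [simp]: "sub (up \<theta>) (ren Suc t) = ren Suc (sub \<theta> t)"
  by (simp add: sub_ren ren_sub) (simp add: up_def)

lemma ren_case_nat_ren_Suc [simp]:
  "ren (case_nat 0 (\<lambda>i. Suc (\<rho> i))) (ren Suc t) = ren Suc (ren \<rho> t)"
  by (simp add: ren_ren)

lemma up_simps [simp]:
  "up \<theta> 0 = Var 0" "up \<theta> (Suc i) = ren Suc (\<theta> i)"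
  "up \<theta> (numeral k) = ren Suc (\<theta> (pred_numeral k))"
  by (simp_all add: up_def)

section \<open>Well-formedness under substitution\<close>

lemma wff_fsub:
  assumes "wff \<Gamma> A" "\<And>i. i < length \<Gamma> \<Longrightarrow> tyof \<Delta> (\<theta> i) = Some (\<Gamma> ! i)"
  shows "wff \<Delta> (fsub \<theta> A)"
  using assms
proof (induction A arbitrary: \<theta> \<Gamma> \<Delta>)
  case (Eq \<tau> t u)
  then show ?case by (auto simp: has_type_iff intro: tyof_sub)
next
  case (All \<sigma> A)
  have "wff (\<sigma> # \<Delta>) (fsub (up \<theta>) A)"
    by (rule All.IH[of "\<sigma> # \<Gamma>"]) (use All.prems in \<open>auto simp: up_def split: nat.split\<close>)
  then show ?case by simp
next
  case (Ex \<sigma> A)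
  have "wff (\<sigma> # \<Delta>) (fsub (up \<theta>) A)"
    by (rule Ex.IH[of "\<sigma> # \<Gamma>"]) (use Ex.prems in \<open>auto simp: up_def split: nat.split\<close>)
  then show ?case by simp
qed (simp; blast)+

lemma wff_inst_0: "wff (\<tau> # \<Gamma>) A \<Longrightarrow> tyof \<Gamma> t = Some \<tau> \<Longrightarrow> wff \<Gamma> (inst 0 t A)"
  unfolding inst_def by (erule wff_fsub) (auto split: nat.split)

lemma wff_inst_1:
  "wff (\<tau> # \<Gamma>) A \<Longrightarrow> tyof (\<sigma> # \<Gamma>) t = Some \<tau> \<Longrightarrow> wff (\<sigma> # \<Gamma>) (inst 1 t A)"
  unfolding inst_def by (erule wff_fsub) (auto simp: nth_Cons' split: nat.split)

lemma wff_inst_2: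
  "wff (\<tau> # \<Gamma>) A \<Longrightarrow> tyof (\<sigma> # \<sigma>' # \<Gamma>) t = Some \<tau> \<Longrightarrow> wff (\<sigma> # \<sigma>' # \<Gamma>) (inst 2 t A)"
  unfolding inst_def by (erule wff_fsub) (auto simp: nth_Cons' split: nat.split)


section \<open>Derived rules\<close>

abbreviation Th :: axiom_system where
  "Th \<equiv> HA_omega \<union> BI \<union> CONT"

lemma HA_ax: "(\<Gamma>, A) \<in> HA_omega \<Longrightarrow> wff \<Gamma> A \<Longrightarrow> derivable Th \<Gamma> H A"
  by (rule derivable.ax) auto

text \<open>Derivability is bundled with the types of both sides, so each rule below also delivers
  the typing facts that later uses of the axioms ask for.\<close>

definition eqv :: "ty list \<Rightarrow> fm set \<Rightarrow> ty \<Rightarrow> tm \<Rightarrow> tm \<Rightarrow> bool" where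
  "eqv \<Gamma> H \<tau> t u \<longleftrightarrow> tyof \<Gamma> t = Some \<tau> \<and> tyof \<Gamma> u = Some \<tau> \<and> derivable Th \<Gamma> H (Eq \<tau> t u)"

lemma eqv_ax:
  "(\<Gamma>, Eq \<tau> t u) \<in> HA_omega \<Longrightarrow> tyof \<Gamma> t = Some \<tau> \<Longrightarrow> tyof \<Gamma> u = Some \<tau> \<Longrightarrow> eqv \<Gamma> H \<tau> t u"
  by (auto simp: eqv_def has_type_iff intro: HA_ax)

lemma eqv_refl: "tyof \<Gamma> t = Some \<tau> \<Longrightarrow> eqv \<Gamma> H \<tau> t t"
  by (rule eqv_ax) (auto intro: HA_omega.refl)

lemma eqv_replace:
  assumes "eqv \<Gamma> H \<tau> t u" "wff (\<tau> # \<Gamma>) A" "derivable Th \<Gamma> H (inst 0 t A)"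
  shows "derivable Th \<Gamma> H (inst 0 u A)"
proof -
  have "derivable Th \<Gamma> H (Eq \<tau> t u \<^bold>\<longrightarrow> inst 0 t A \<^bold>\<longrightarrow> inst 0 u A)"
    by (rule HA_ax[OF HA_omega.leibniz])
      (use assms in \<open>auto simp: eqv_def has_type_iff intro: wff_inst_0\<close>)
  then show ?thesis using assms unfolding eqv_def by (blast intro: derivable.impE)
qed

text \<open>Leibniz for the formula \<open>z = t\<close> in \<open>z\<close>, starting from
  \<open>t = t\<close>; transitivity uses the formula \<open>t = z\<close>.\<close>

lemma eqv_sym:
  assumes "eqv \<Gamma> H \<tau> t u"
  shows "eqv \<Gamma> H \<tau> u t"
  using eqv_replace[OF assms, of "Eq \<tau> (Var 0) (ren Suc t)"] assms eqv_refl[of \<Gamma> t \<tau> H]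
  by (auto simp: eqv_def has_type_iff inst_def)

lemma eqv_trans:
  assumes "eqv \<Gamma> H \<tau> t u" "eqv \<Gamma> H \<tau> u w"
  shows "eqv \<Gamma> H \<tau> t w"
  using eqv_replace[OF assms(2), of "Eq \<tau> (ren Suc t) (Var 0)"] assms
  by (auto simp: eqv_def has_type_iff inst_def)

lemma eqv_App:
  assumes "eqv \<Gamma> H (\<sigma> \<rightarrow> \<tau>) t t'" "eqv \<Gamma> H \<sigma> u u'"
  shows "eqv \<Gamma> H \<tau> (t \<cdot> u) (t' \<cdot> u')"
proof -
  have ty: "tyof \<Gamma> t = Some (\<sigma> \<rightarrow> \<tau>)" "tyof \<Gamma> t' = Some (\<sigma> \<rightarrow> \<tau>)" "tyof \<Gamma> u = Some \<sigma>" "tyof \<Gamma> u' = Some \<sigma>"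
    using assms by (auto simp: eqv_def)
  have "eqv \<Gamma> H \<tau> (t \<cdot> u) (t' \<cdot> u)"
    using eqv_replace[OF assms(1), of "Eq \<tau> (ren Suc (t \<cdot> u)) (Var 0 \<cdot> ren Suc u)"]
      eqv_refl[of \<Gamma> "t \<cdot> u" \<tau> H] ty
    by (auto simp: eqv_def has_type_iff inst_def)
  moreover have "eqv \<Gamma> H \<tau> (t' \<cdot> u) (t' \<cdot> u')"
    using eqv_replace[OF assms(2), of "Eq \<tau> (ren Suc (t' \<cdot> u)) (ren Suc t' \<cdot> Var 0)"]
      eqv_refl[of \<Gamma> "t' \<cdot> u" \<tau> H] ty
    by (auto simp: eqv_def has_type_iff inst_def)
  ultimately show ?thesis by (rule eqv_trans)
qed

text \<open>The axiom quantifies over both functions. Instantiated, it asks for pointwise equality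
  at a fresh variable, which \<open>allI\<close> obtains from the extended context with lifted
  hypotheses.\<close>

lemma eqv_ext:
  assumes "tyof \<Gamma> f = Some (\<sigma> \<rightarrow> \<tau>)" "tyof \<Gamma> g = Some (\<sigma> \<rightarrow> \<tau>)"
    and "eqv (\<sigma> # \<Gamma>) (lift ` H) \<tau> (ren Suc f \<cdot> Var 0) (ren Suc g \<cdot> Var 0)"
  shows "eqv \<Gamma> H (\<sigma> \<rightarrow> \<tau>) f g"
proof -
  let ?A = "All \<sigma> (Eq \<tau> (ren Suc f \<cdot> Var 0) (ren Suc g \<cdot> Var 0))"
  have "derivable Th \<Gamma> H (All (\<sigma> \<rightarrow> \<tau>) (All (\<sigma> \<rightarrow> \<tau>)
      (All \<sigma> (Eq \<tau> (Var 2 \<cdot> Var 0) (Var 1 \<cdot> Var 0)) \<^bold>\<longrightarrow> Eq (\<sigma> \<rightarrow> \<tau>) (Var 1) (Var 0))))"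
    by (rule HA_ax[OF HA_omega.ext]) (auto simp: has_type_iff)
  from derivable.allE[OF derivable.allE[OF this, of f, unfolded inst_def, simplified], of g]
  have "derivable Th \<Gamma> H (?A \<^bold>\<longrightarrow> Eq (\<sigma> \<rightarrow> \<tau>) f g)"
    using assms(1,2) by (simp add: has_type_iff inst_def)
  moreover have "derivable Th \<Gamma> H ?A"
    using assms(3) by (auto simp: eqv_def intro: derivable.allI)
  ultimately show ?thesis using assms(1,2) by (auto simp: eqv_def intro: derivable.impE)
qed

lemma eqv_beta:
  assumes "tyof (\<sigma> # \<Gamma>) t = Some \<tau>" "tyof \<Gamma> u = Some \<sigma>"
  shows "eqv \<Gamma> H \<tau> (Lam \<sigma> t \<cdot> u) (sub (case_nat u Var) t)"
  by (rule eqv_ax[OF HA_omega.beta])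
    (use assms in \<open>auto intro: tyof_sub[where \<Gamma> = "\<sigma> # \<Gamma>"] split: nat.split\<close>)


section \<open>Terms modulo provable equality\<close>

text \<open>Provable equality in a fixed context becomes equality in HOL by passing to equivalence
  classes. Application is total on classes; ill-typed terms all have the class \<open>{}\<close>.\<close>
locale ctx =
  fixes \<Gamma> :: "ty list" and H :: "fm set"
begin

definition val :: "tm \<Rightarrow> tm set"  ("\<langle>_\<rangle>") where
  "\<langle>t\<rangle> = {u. \<exists>\<tau>. eqv \<Gamma> H \<tau> t u}"

text \<open>The type is read off from an arbitrary representative; \<open>tyof_cong\<close> makes it
  independent of the choice.\<close>

definition vty :: "tm set \<Rightarrow> ty option" where
  "vty a = (if a \<in> range val then tyof \<Gamma> (SOME t. a = \<langle>t\<rangle>) else None)"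

definition ap :: "tm set \<Rightarrow> tm set \<Rightarrow> tm set"  (infixl "\<bullet>" 100) where
  "a \<bullet> b = (if a \<in> range val \<and> b \<in> range val
     then \<langle>(SOME t. a = \<langle>t\<rangle>) \<cdot> (SOME u. b = \<langle>u\<rangle>)\<rangle> else {})"

lemma val_eqI: "eqv \<Gamma> H \<tau> t u \<Longrightarrow> \<langle>t\<rangle> = \<langle>u\<rangle>"
  unfolding val_def using eqv_def eqv_sym eqv_trans by (smt (verit) Collect_cong option.inject)

lemma val_eqD: "\<langle>t\<rangle> = \<langle>u\<rangle> \<Longrightarrow> tyof \<Gamma> t = Some \<tau> \<Longrightarrow> eqv \<Gamma> H \<tau> t u"
  unfolding val_def using eqv_refl eqv_def eqv_sym by (smt (verit) mem_Collect_eq option.inject)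

lemma tyof_cong: "\<langle>t\<rangle> = \<langle>u\<rangle> \<Longrightarrow> tyof \<Gamma> t = tyof \<Gamma> u"
  by (metis eqv_def not_Some_eq val_eqD)

lemma val_None: "tyof \<Gamma> t = None \<Longrightarrow> \<langle>t\<rangle> = {}"
  by (auto simp: val_def eqv_def)

text \<open>By \<open>eqv_App\<close> the class of an application does not depend on the
  representatives. An untypable application remains untypable when they change, and then both
  classes are \<open>{}\<close>.\<close>

lemma val_App: "\<langle>t \<cdot> u\<rangle> = \<langle>t\<rangle> \<bullet> \<langle>u\<rangle>"
proof -
  define t' u' where "t' = (SOME t'. \<langle>t\<rangle> = \<langle>t'\<rangle>)" and "u' = (SOME u'. \<langle>u\<rangle> = \<langle>u'\<rangle>)"
  have eq: "\<langle>t\<rangle> = \<langle>t'\<rangle>" "\<langle>u\<rangle> = \<langle>u'\<rangle>"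
    unfolding t'_def u'_def by (metis (mono_tags, lifting) someI)+
  have "\<langle>t \<cdot> u\<rangle> = \<langle>t' \<cdot> u'\<rangle>"
  proof (cases "tyof \<Gamma> (t \<cdot> u)")
    case None
    then show ?thesis using eq[THEN tyof_cong] by (simp add: val_None)
  next
    case (Some \<tau>)
    then obtain \<sigma> where "tyof \<Gamma> t = Some (\<sigma> \<rightarrow> \<tau>)" "tyof \<Gamma> u = Some \<sigma>"
      by (auto simp: tyapp_eq_Some)
    then show ?thesis by (intro val_eqI[OF eqv_App] eq[THEN val_eqD])
  qed
  then show ?thesis by (simp add: ap_def t'_def u'_def)
qed

lemma vty_val: "vty \<langle>t\<rangle> = tyof \<Gamma> t"
proof -
  have "\<langle>t\<rangle> = \<langle>SOME t'. \<langle>t\<rangle> = \<langle>t'\<rangle>\<rangle>" by (metis (mono_tags, lifting) someI)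
  then show ?thesis unfolding vty_def by (metis rangeI tyof_cong)
qed

lemma vtyD: "vty a = Some \<tau> \<Longrightarrow> \<exists>t. a = \<langle>t\<rangle> \<and> tyof \<Gamma> t = Some \<tau>"
  by (metis option.distinct(1) rangeE vty_def vty_val)

lemma vty_ap: "vty (a \<bullet> b) = tyapp (vty a) (vty b)"
proof (cases "a \<in> range val \<and> b \<in> range val")
  case True
  then show ?thesis by (metis rangeE tyof.simps(3) val_App vty_val)
next
  case False
  \<comment> \<open>The empty set is itself a class, that of any untypable term; the first index
    outside \<Gamma> supplies one.\<close>
  have "vty {} = None"
    using vty_val[of "Var (length \<Gamma>)"] val_None[of "Var (length \<Gamma>)"] by simp
  moreover have "vty a = None \<or> vty b = None" using False by (auto simp: vty_def)
  ultimately show ?thesis using False by (auto simp: ap_def)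
qed

lemma val_hyp: "Eq \<tau> t u \<in> H \<Longrightarrow> tyof \<Gamma> t = Some \<tau> \<Longrightarrow> tyof \<Gamma> u = Some \<tau> \<Longrightarrow> \<langle>t\<rangle> = \<langle>u\<rangle>"
  by (rule val_eqI[where \<tau> = \<tau>]) (auto simp: eqv_def has_type_iff intro: derivable.hyp)

lemma derivable_EqI: "\<langle>t\<rangle> = \<langle>u\<rangle> \<Longrightarrow> tyof \<Gamma> t = Some \<tau> \<Longrightarrow> derivable Th \<Gamma> H (Eq \<tau> t u)"
  using val_eqD eqv_def by blast

lemma val_eqI_derivable:
  "derivable Th \<Gamma> H (Eq \<tau> t u) \<Longrightarrow> tyof \<Gamma> t = Some \<tau> \<Longrightarrow> tyof \<Gamma> u = Some \<tau> \<Longrightarrow> \<langle>t\<rangle> = \<langle>u\<rangle>"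
  by (rule val_eqI[where \<tau> = \<tau>]) (auto simp: eqv_def)

section \<open>Extensionality and computation on classes\<close>

lemma val_ext:
  assumes "tyof \<Gamma> f = Some (\<sigma> \<rightarrow> \<tau>)" "tyof \<Gamma> g = Some (\<sigma> \<rightarrow> \<tau>)"
    and "ctx.val (\<sigma> # \<Gamma>) (lift ` H) (ren Suc f \<cdot> Var 0) = ctx.val (\<sigma> # \<Gamma>) (lift ` H) (ren Suc g \<cdot> Var 0)"
  shows "\<langle>f\<rangle> = \<langle>g\<rangle>"
  by (rule val_eqI[OF eqv_ext]) (use assms in \<open>auto intro: ctx.val_eqD\<close>)

lemma val_beta: "tyof \<Gamma> (Lam \<sigma> t \<cdot> u) \<noteq> None \<Longrightarrow> \<langle>Lam \<sigma> t \<cdot> u\<rangle> = \<langle>sub (case_nat u Var) t\<rangle>"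
proof -
  assume "tyof \<Gamma> (Lam \<sigma> t \<cdot> u) \<noteq> None"
  then obtain \<tau> where "tyof (\<sigma> # \<Gamma>) t = Some \<tau>" "tyof \<Gamma> u = Some \<sigma>"
    by (auto simp: tyapp_eq_Some)
  then show ?thesis by (rule val_eqI[OF eqv_beta])
qed

lemma val_nrec_Zero:
  "tyof \<Gamma> (Con (NRec \<tau>) \<cdot> a \<cdot> f \<cdot> Con Zero) \<noteq> None \<Longrightarrow> \<langle>Con (NRec \<tau>) \<cdot> a \<cdot> f \<cdot> Con Zero\<rangle> = \<langle>a\<rangle>"
  by (rule val_eqI[of \<tau>], rule eqv_ax[OF HA_omega.nrec_Zero])
    (auto simp: tyapp_eq_Some simp del: tyapp.simps)

lemma val_nrec_Succ:
  "tyof \<Gamma> (Con (NRec \<tau>) \<cdot> a \<cdot> f \<cdot> (Con Succ \<cdot> n)) \<noteq> None \<Longrightarrow>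
    \<langle>Con (NRec \<tau>) \<cdot> a \<cdot> f \<cdot> (Con Succ \<cdot> n)\<rangle> = \<langle>f \<cdot> n \<cdot> (Con (NRec \<tau>) \<cdot> a \<cdot> f \<cdot> n)\<rangle>"
  by (rule val_eqI[of \<tau>], rule eqv_ax[OF HA_omega.nrec_Succ])
    (auto simp: tyapp_eq_Some simp del: tyapp.simps)

lemma val_srec_Empty:
  "tyof \<Gamma> (Con (SRec X \<tau>) \<cdot> a \<cdot> f \<cdot> Con (Empty X)) \<noteq> None \<Longrightarrow>
    \<langle>Con (SRec X \<tau>) \<cdot> a \<cdot> f \<cdot> Con (Empty X)\<rangle> = \<langle>a\<rangle>"
  by (rule val_eqI[of \<tau>], rule eqv_ax[OF HA_omega.srec_Empty])
    (auto simp: tyapp_eq_Some simp del: tyapp.simps)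

lemma val_srec_Snoc:
  "tyof \<Gamma> (Con (SRec X \<tau>) \<cdot> a \<cdot> f \<cdot> (Con (Snoc X) \<cdot> s \<cdot> x)) \<noteq> None \<Longrightarrow>
    \<langle>Con (SRec X \<tau>) \<cdot> a \<cdot> f \<cdot> (Con (Snoc X) \<cdot> s \<cdot> x)\<rangle> = \<langle>f \<cdot> s \<cdot> x \<cdot> (Con (SRec X \<tau>) \<cdot> a \<cdot> f \<cdot> s)\<rangle>"
  by (rule val_eqI[of \<tau>], rule eqv_ax[OF HA_omega.srec_Snoc])
    (auto simp: tyapp_eq_Some simp del: tyapp.simps)

lemma val_App_cong: "\<langle>t\<rangle> = \<langle>t'\<rangle> \<Longrightarrow> \<langle>t \<cdot> u\<rangle> = \<langle>t' \<cdot> u\<rangle>"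
  by (simp add: val_App)

lemmas val_rec = val_nrec_Zero val_nrec_Succ val_srec_Empty val_srec_Snoc

text \<open>Head reduction on classes: a beta redex may be followed by up to three further
  arguments, a recursor redex by one.\<close>

lemmas head_reduce =
  val_beta val_beta[THEN val_App_cong] val_beta[THEN val_App_cong, THEN val_App_cong]
  val_beta[THEN val_App_cong, THEN val_App_cong, THEN val_App_cong]
  val_rec val_rec[THEN val_App_cong]

end


section \<open>Sequences\<close>

text \<open>\<open>\<lambda>s u. s * u\<close> for finite sequences \<open>s\<close> and \<open>u\<close>\<close>
definition concat_tm :: "ty \<Rightarrow> tm" where
  "concat_tm X = Lam (Seq X) (Con (SRec X (Seq X)) \<cdot> Var 0
     \<cdot> Lam (Seq X) (Lam X (Lam (Seq X) (Con (Snoc X) \<cdot> Var 0 \<cdot> Var 1))))"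

text \<open>\<open>\<lambda>n m. n + m\<close>, with \<open>(n + 1) + m = n + (m + 1)\<close>\<close>
definition acc_tm :: tm where
  "acc_tm = Con (NRec (Nat \<rightarrow> Nat)) \<cdot> Lam Nat (Var 0)
     \<cdot> Lam Nat (Lam (Nat \<rightarrow> Nat) (Lam Nat (Var 1 \<cdot> (Con Succ \<cdot> Var 0))))"

text \<open>\<open>\<lambda>q s \<alpha>. q(s * \<alpha>)\<close>\<close>
definition fsection_tm :: "ty \<Rightarrow> ty \<Rightarrow> tm" where
  "fsection_tm X R = Lam (Stream X \<rightarrow> R) (Lam (Seq X) (Lam (Stream X)
     (Var 2 \<cdot> (append_tm X \<cdot> Var 1 \<cdot> Var 0))))"

abbreviation Sel :: "ty \<Rightarrow> ty \<Rightarrow> ty" where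
  "Sel X R \<equiv> Seq X \<rightarrow> (X \<rightarrow> R) \<rightarrow> Stream X"

text \<open>\<open>\<lambda>\<epsilon> s u. \<epsilon>\<^sub>s\<^sub>*\<^sub>u\<close>\<close>
definition shift_tm :: "ty \<Rightarrow> ty \<Rightarrow> tm" where
  "shift_tm X R = Lam (Sel X R) (Lam (Seq X) (Lam (Seq X)
     (Var 2 \<cdot> (concat_tm X \<cdot> Var 1 \<cdot> Var 0))))"

lemma tyof_comb [simp]:
  "tyof \<Gamma> (cons_tm X) = Some (X \<rightarrow> Stream X \<rightarrow> Stream X)"
  "tyof \<Gamma> (append_tm X) = Some (Seq X \<rightarrow> Stream X \<rightarrow> Stream X)"
  "tyof \<Gamma> (prefix_tm X) = Some (Stream X \<rightarrow> Nat \<rightarrow> Seq X)"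
  "tyof \<Gamma> (section_tm X R) = Some ((Stream X \<rightarrow> R) \<rightarrow> X \<rightarrow> Stream X \<rightarrow> R)"
  "tyof \<Gamma> (concat_tm X) = Some (Seq X \<rightarrow> Seq X \<rightarrow> Seq X)"
  "tyof \<Gamma> acc_tm = Some (Nat \<rightarrow> Nat \<rightarrow> Nat)"
  "tyof \<Gamma> (fsection_tm X R) = Some ((Stream X \<rightarrow> R) \<rightarrow> Seq X \<rightarrow> Stream X \<rightarrow> R)"
  "tyof \<Gamma> (shift_tm X R) = Some (Sel X R \<rightarrow> Seq X \<rightarrow> Sel X R)"
  by (simp_all add: cons_tm_def append_tm_def prefix_tm_def section_tm_def concat_tm_def
      acc_tm_def fsection_tm_def shift_tm_def)

lemma sub_comb [simp]:
  "sub \<theta> (cons_tm X) = cons_tm X" "sub \<theta> (append_tm X) = append_tm X"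
  "sub \<theta> (prefix_tm X) = prefix_tm X" "sub \<theta> (section_tm X R) = section_tm X R"
  "sub \<theta> (concat_tm X) = concat_tm X" "sub \<theta> acc_tm = acc_tm"
  "sub \<theta> (fsection_tm X R) = fsection_tm X R" "sub \<theta> (shift_tm X R) = shift_tm X R"
  by (simp_all add: cons_tm_def append_tm_def prefix_tm_def section_tm_def concat_tm_def
      acc_tm_def fsection_tm_def shift_tm_def)

lemma ren_comb [simp]:
  "ren \<rho> (cons_tm X) = cons_tm X" "ren \<rho> (append_tm X) = append_tm X"
  "ren \<rho> (prefix_tm X) = prefix_tm X" "ren \<rho> (section_tm X R) = section_tm X R"
  "ren \<rho> (concat_tm X) = concat_tm X" "ren \<rho> acc_tm = acc_tm"
  "ren \<rho> (fsection_tm X R) = fsection_tm X R" "ren \<rho> (shift_tm X R) = shift_tm X R"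
  by (simp_all add: cons_tm_def append_tm_def prefix_tm_def section_tm_def concat_tm_def
      acc_tm_def fsection_tm_def shift_tm_def)

section \<open>Equations of the sequence combinators\<close>

context ctx
begin

text \<open>The arguments are arbitrary classes: \<open>vtyD\<close> picks typed representatives, on
  which head reduction evaluates the closed combinator. Most equations below are obtained in this
  way.\<close>

lemma ap_cons_Zero:
  assumes "vty x = Some X" "vty \<alpha> = Some (Stream X)"
  shows "\<langle>cons_tm X\<rangle> \<bullet> x \<bullet> \<alpha> \<bullet> \<langle>Con Zero\<rangle> = x"
  using assms[THEN vtyD]
  by (auto simp: cons_tm_def head_reduce simp flip: val_App)

lemma ap_cons_Succ:
  assumes "vty x = Some X" "vty \<alpha> = Some (Stream X)" "vty n = Some Nat"
  shows "\<langle>cons_tm X\<rangle> \<bullet> x \<bullet> \<alpha> \<bullet> (\<langle>Con Succ\<rangle> \<bullet> n) = \<alpha> \<bullet> n"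
  using assms[THEN vtyD]
  by (auto simp: cons_tm_def head_reduce simp flip: val_App)

lemma ap_append_Empty:
  assumes "vty \<alpha> = Some (Stream X)"
  shows "\<langle>append_tm X\<rangle> \<bullet> \<langle>Con (Empty X)\<rangle> \<bullet> \<alpha> = \<alpha>"
  using assms[THEN vtyD]
  by (auto simp: append_tm_def head_reduce simp flip: val_App)

lemma ap_append_Snoc:
  assumes "vty s = Some (Seq X)" "vty x = Some X" "vty \<alpha> = Some (Stream X)"
  shows "\<langle>append_tm X\<rangle> \<bullet> (\<langle>Con (Snoc X)\<rangle> \<bullet> s \<bullet> x) \<bullet> \<alpha> = \<langle>append_tm X\<rangle> \<bullet> s \<bullet> (\<langle>cons_tm X\<rangle> \<bullet> x \<bullet> \<alpha>)"
  using assms[THEN vtyD]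
  by (auto simp: append_tm_def head_reduce numeral_2_eq_2 simp flip: val_App)

lemma ap_prefix_Zero:
  assumes "vty \<alpha> = Some (Stream X)"
  shows "\<langle>prefix_tm X\<rangle> \<bullet> \<alpha> \<bullet> \<langle>Con Zero\<rangle> = \<langle>Con (Empty X)\<rangle>"
  using assms[THEN vtyD]
  by (auto simp: prefix_tm_def head_reduce simp flip: val_App)

text \<open>Exposes the recursor. In the successor equation the recursive call appears as a bare
  recursor term, which this equation folds back into \<open>prefix_tm\<close>;
  \<open>val_concat\<close> serves \<open>concat_tm\<close> in the same way.\<close>

lemma val_prefix:
  assumes "tyof \<Gamma> \<alpha> = Some (Stream X)" "tyof \<Gamma> n = Some Nat"
  shows "\<langle>prefix_tm X \<cdot> \<alpha> \<cdot> n\<rangle> = \<langle>Con (NRec (Seq X)) \<cdot> Con (Empty X)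
      \<cdot> Lam Nat (Lam (Seq X) (Con (Snoc X) \<cdot> Var 0 \<cdot> (ren Suc (ren Suc \<alpha>) \<cdot> Var 1))) \<cdot> n\<rangle>"
  using assms by (simp add: prefix_tm_def head_reduce)

lemma ap_prefix_Succ:
  assumes "vty \<alpha> = Some (Stream X)" "vty n = Some Nat"
  shows "\<langle>prefix_tm X\<rangle> \<bullet> \<alpha> \<bullet> (\<langle>Con Succ\<rangle> \<bullet> n) =
    \<langle>Con (Snoc X)\<rangle> \<bullet> (\<langle>prefix_tm X\<rangle> \<bullet> \<alpha> \<bullet> n) \<bullet> (\<alpha> \<bullet> n)"
proof -
  obtain t m where [simp]: "\<alpha> = \<langle>t\<rangle>" "n = \<langle>m\<rangle>" "tyof \<Gamma> t = Some (Stream X)" "tyof \<Gamma> m = Some Nat"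
    using assms[THEN vtyD] by auto
  let ?f = "Lam Nat (Lam (Seq X) (Con (Snoc X) \<cdot> Var 0 \<cdot> (ren Suc (ren Suc t) \<cdot> Var 1)))"
  have "\<langle>prefix_tm X \<cdot> t \<cdot> (Con Succ \<cdot> m)\<rangle> =
      \<langle>Con (Snoc X) \<cdot> (Con (NRec (Seq X)) \<cdot> Con (Empty X) \<cdot> ?f \<cdot> m) \<cdot> (t \<cdot> m)\<rangle>"
    by (simp add: val_prefix head_reduce)
  also have "\<dots> = \<langle>Con (Snoc X) \<cdot> (prefix_tm X \<cdot> t \<cdot> m) \<cdot> (t \<cdot> m)\<rangle>"
    using val_prefix[of t X m] by (simp add: val_App)
  finally show ?thesis by (simp add: val_App)
qed

lemma ap_section:
  assumes "vty q = Some (Stream X \<rightarrow> R)" "vty x = Some X" "vty \<alpha> = Some (Stream X)"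
  shows "\<langle>section_tm X R\<rangle> \<bullet> q \<bullet> x \<bullet> \<alpha> = q \<bullet> (\<langle>cons_tm X\<rangle> \<bullet> x \<bullet> \<alpha>)"
  using assms[THEN vtyD]
  by (auto simp: section_tm_def head_reduce simp flip: val_App)

lemma ap_fsection:
  assumes "vty q = Some (Stream X \<rightarrow> R)" "vty s = Some (Seq X)" "vty \<alpha> = Some (Stream X)"
  shows "\<langle>fsection_tm X R\<rangle> \<bullet> q \<bullet> s \<bullet> \<alpha> = q \<bullet> (\<langle>append_tm X\<rangle> \<bullet> s \<bullet> \<alpha>)"
  using assms[THEN vtyD]
  by (auto simp: fsection_tm_def head_reduce simp flip: val_App)

lemma ap_shift:
  assumes "vty \<epsilon> = Some (Sel X R)" "vty s = Some (Seq X)" "vty u = Some (Seq X)"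
  shows "\<langle>shift_tm X R\<rangle> \<bullet> \<epsilon> \<bullet> s \<bullet> u = \<epsilon> \<bullet> (\<langle>concat_tm X\<rangle> \<bullet> s \<bullet> u)"
  using assms[THEN vtyD]
  by (auto simp: shift_tm_def head_reduce simp flip: val_App)

lemma ap_concat_Empty:
  assumes "vty s = Some (Seq X)"
  shows "\<langle>concat_tm X\<rangle> \<bullet> s \<bullet> \<langle>Con (Empty X)\<rangle> = s"
  using assms[THEN vtyD]
  by (auto simp: concat_tm_def head_reduce simp flip: val_App)

lemma val_concat:
  assumes "tyof \<Gamma> s = Some (Seq X)" "tyof \<Gamma> u = Some (Seq X)"
  shows "\<langle>concat_tm X \<cdot> s \<cdot> u\<rangle> = \<langle>Con (SRec X (Seq X)) \<cdot> s
     \<cdot> Lam (Seq X) (Lam X (Lam (Seq X) (Con (Snoc X) \<cdot> Var 0 \<cdot> Var 1))) \<cdot> u\<rangle>"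
  using assms by (simp add: concat_tm_def head_reduce)

lemma ap_concat_Snoc:
  assumes "vty s = Some (Seq X)" "vty u = Some (Seq X)" "vty x = Some X"
  shows "\<langle>concat_tm X\<rangle> \<bullet> s \<bullet> (\<langle>Con (Snoc X)\<rangle> \<bullet> u \<bullet> x) = \<langle>Con (Snoc X)\<rangle> \<bullet> (\<langle>concat_tm X\<rangle> \<bullet> s \<bullet> u) \<bullet> x"
proof -
  obtain t v y where [simp]: "s = \<langle>t\<rangle>" "u = \<langle>v\<rangle>" "x = \<langle>y\<rangle>"
      "tyof \<Gamma> t = Some (Seq X)" "tyof \<Gamma> v = Some (Seq X)" "tyof \<Gamma> y = Some X"
    using assms[THEN vtyD] by auto
  let ?f = "Lam (Seq X) (Lam X (Lam (Seq X) (Con (Snoc X) \<cdot> Var 0 \<cdot> Var 1)))"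
  have "\<langle>concat_tm X \<cdot> t \<cdot> (Con (Snoc X) \<cdot> v \<cdot> y)\<rangle> =
      \<langle>Con (Snoc X) \<cdot> (Con (SRec X (Seq X)) \<cdot> t \<cdot> ?f \<cdot> v) \<cdot> y\<rangle>"
    by (simp add: val_concat head_reduce)
  also have "\<dots> = \<langle>Con (Snoc X) \<cdot> (concat_tm X \<cdot> t \<cdot> v) \<cdot> y\<rangle>"
    using val_concat[of t X v] by (simp add: val_App)
  finally show ?thesis by (simp add: val_App)
qed

lemma ap_acc_Zero:
  assumes "vty m = Some Nat"
  shows "\<langle>acc_tm\<rangle> \<bullet> \<langle>Con Zero\<rangle> \<bullet> m = m"
  using assms[THEN vtyD]
  by (auto simp: acc_tm_def head_reduce simp flip: val_App)

lemma ap_acc_Succ: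
  assumes "vty n = Some Nat" "vty m = Some Nat"
  shows "\<langle>acc_tm\<rangle> \<bullet> (\<langle>Con Succ\<rangle> \<bullet> n) \<bullet> m = \<langle>acc_tm\<rangle> \<bullet> n \<bullet> (\<langle>Con Succ\<rangle> \<bullet> m)"
  using assms[THEN vtyD]
  by (auto simp: acc_tm_def head_reduce simp flip: val_App)

end

text \<open>The context is left free here, since the proofs below compute both in a given context
  and in its extensions under binders.\<close>

lemmas val_simps =
  ctx.val_App ctx.vty_val ctx.vty_ap
  ctx.ap_cons_Zero ctx.ap_cons_Succ ctx.ap_append_Empty ctx.ap_append_Snoc
  ctx.ap_prefix_Zero ctx.ap_prefix_Succ ctx.ap_section ctx.ap_fsection ctx.ap_shift
  ctx.ap_concat_Empty ctx.ap_concat_Snoc ctx.ap_acc_Zero ctx.ap_acc_Succ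

text \<open>The step has to work from any hypothesis set \<open>H'\<close> that contains the
  induction hypothesis, which hides the lifted ambient hypotheses.\<close>

lemma nat_induct_derivable:
  assumes "wff (Nat # \<Gamma>) A" "tyof \<Gamma> n = Some Nat"
    and "derivable Th \<Gamma> H (inst 0 (Con Zero) A)"
    and step: "\<And>H'. A \<in> H' \<Longrightarrow> derivable Th (Nat # \<Gamma>) H' (inst 1 (Con Succ \<cdot> Var 0) A)"
  shows "derivable Th \<Gamma> H (inst 0 n A)"
proof -
  have "derivable Th \<Gamma> H (inst 0 (Con Zero) A \<^bold>\<longrightarrow>
      All Nat (A \<^bold>\<longrightarrow> inst 1 (Con Succ \<cdot> Var 0) A) \<^bold>\<longrightarrow> All Nat A)"
    by (rule HA_ax[OF HA_omega.nat_induct]) (use assms(1) in \<open>simp add: wff_inst_0 wff_inst_1[simplified]\<close>)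
  moreover have "derivable Th \<Gamma> H (All Nat (A \<^bold>\<longrightarrow> inst 1 (Con Succ \<cdot> Var 0) A))"
    by (intro derivable.allI derivable.impI step) (use assms(1) in auto)
  ultimately have "derivable Th \<Gamma> H (All Nat A)"
    using assms(3) by (blast intro: derivable.impE)
  then show ?thesis using assms(2) by (auto simp: has_type_iff intro: derivable.allE)
qed

text \<open>The step runs under two new variables, the sequence and its new last entry; the
  induction hypothesis is introduced between them and so arrives lifted once.\<close>

lemma seq_induct_derivable:
  assumes "wff (Seq X # \<Gamma>) A" "tyof \<Gamma> s = Some (Seq X)"
    and "derivable Th \<Gamma> H (inst 0 (Con (Empty X)) A)"
    and step: "\<And>H'. lift A \<in> H' \<Longrightarrow>
      derivable Th (X # Seq X # \<Gamma>) H' (inst 2 (Con (Snoc X) \<cdot> Var 1 \<cdot> Var 0) A)"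
  shows "derivable Th \<Gamma> H (inst 0 s A)"
proof -
  have "derivable Th \<Gamma> H (inst 0 (Con (Empty X)) A \<^bold>\<longrightarrow>
      All (Seq X) (A \<^bold>\<longrightarrow> All X (inst 2 (Con (Snoc X) \<cdot> Var 1 \<cdot> Var 0) A)) \<^bold>\<longrightarrow> All (Seq X) A)"
    by (rule HA_ax[OF HA_omega.seq_induct]) (use assms(1) in \<open>simp add: wff_inst_0 wff_inst_2\<close>)
  moreover have "derivable Th \<Gamma> H (All (Seq X) (A \<^bold>\<longrightarrow> All X (inst 2 (Con (Snoc X) \<cdot> Var 1 \<cdot> Var 0) A)))"
    by (intro derivable.allI derivable.impI step) (use assms(1) in auto)
  ultimately have "derivable Th \<Gamma> H (All (Seq X) A)"
    using assms(3) by (blast intro: derivable.impE)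
  then show ?thesis using assms(2) by (auto simp: has_type_iff intro: derivable.allE)
qed

section \<open>Induction proofs about addition, appending and prefixes\<close>

context ctx
begin

lemma val_All:
  assumes "derivable Th \<Gamma> H (All \<sigma> (Eq \<tau> a b))" "wff (\<sigma> # \<Gamma>) (Eq \<tau> a b)" "tyof \<Gamma> t = Some \<sigma>"
  shows "\<langle>sub (case_nat t Var) a\<rangle> = \<langle>sub (case_nat t Var) b\<rangle>"
proof -
  have "derivable Th \<Gamma> H (inst 0 t (Eq \<tau> a b))"
    using assms(1,3) by (auto simp: has_type_iff intro: derivable.allE)
  moreover have "wff \<Gamma> (inst 0 t (Eq \<tau> a b))"
    using assms(2,3) by (rule wff_inst_0)
  ultimately show ?thesis
    by (intro val_eqI_derivable[of \<tau>]) (simp_all add: inst_def has_type_iff)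
qed

text \<open>The outer instance \<open>t\<close> is carried under the inner quantifier by
  \<open>up\<close> before \<open>u\<close> fills the inner variable.\<close>

lemma val_All2:
  assumes "derivable Th \<Gamma> H (All \<sigma> (All \<sigma>' (Eq \<tau> a b)))" "wff (\<sigma>' # \<sigma> # \<Gamma>) (Eq \<tau> a b)"
    and "tyof \<Gamma> t = Some \<sigma>" "tyof \<Gamma> u = Some \<sigma>'"
  shows "\<langle>sub (case_nat u Var) (sub (up (case_nat t Var)) a)\<rangle> =
    \<langle>sub (case_nat u Var) (sub (up (case_nat t Var)) b)\<rangle>"
proof (rule val_All)
  have "derivable Th \<Gamma> H (inst 0 t (All \<sigma>' (Eq \<tau> a b)))"
    using assms(1,3) by (auto simp: has_type_iff intro: derivable.allE)
  then show "derivable Th \<Gamma> H (All \<sigma>' (Eq \<tau> (sub (up (case_nat t Var)) a) (sub (up (case_nat t Var)) b)))"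
    by (simp add: inst_def)
  have "wff \<Gamma> (inst 0 t (All \<sigma>' (Eq \<tau> a b)))"
    by (rule wff_inst_0) (use assms in auto)
  then show "wff (\<sigma>' # \<Gamma>) (Eq \<tau> (sub (up (case_nat t Var)) a) (sub (up (case_nat t Var)) b))"
    by (simp add: inst_def)
qed fact

text \<open>Induction on \<open>n\<close> with \<open>m\<close> quantified inside: the recursion
  moves a successor from \<open>n\<close> to \<open>m\<close>, so the induction hypothesis is used
  at \<open>m + 1\<close>.\<close>

lemma acc_Succ_right:
  assumes "vty n = Some Nat" "vty m = Some Nat"
  shows "\<langle>acc_tm\<rangle> \<bullet> n \<bullet> (\<langle>Con Succ\<rangle> \<bullet> m) = \<langle>Con Succ\<rangle> \<bullet> (\<langle>acc_tm\<rangle> \<bullet> n \<bullet> m)"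
proof -
  obtain k l where [simp]: "n = \<langle>k\<rangle>" "m = \<langle>l\<rangle>" "tyof \<Gamma> k = Some Nat" "tyof \<Gamma> l = Some Nat"
    using assms[THEN vtyD] by auto
  let ?A = "All Nat (Eq Nat (acc_tm \<cdot> Var 1 \<cdot> (Con Succ \<cdot> Var 0)) (Con Succ \<cdot> (acc_tm \<cdot> Var 1 \<cdot> Var 0)))"
  have "derivable Th \<Gamma> H (inst 0 k ?A)"
  proof (rule nat_induct_derivable)
    show "derivable Th \<Gamma> H (inst 0 (Con Zero) ?A)"
      by (auto simp: inst_def val_simps intro!: derivable.allI ctx.derivable_EqI)
    fix H' assume "?A \<in> H'"
    then have "lift ?A \<in> lift ` H'" by (rule imageI)
    then have "derivable Th (Nat # Nat # \<Gamma>) (lift ` H') (lift ?A)"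
      by (rule derivable.hyp) (simp add: has_type_iff)
    from ctx.val_All[OF this[simplified], of "Con Succ \<cdot> Var 0"]
    have "ctx.val (Nat # Nat # \<Gamma>) (lift ` H') (acc_tm \<cdot> Var 1 \<cdot> (Con Succ \<cdot> (Con Succ \<cdot> Var 0))) =
      ctx.val (Nat # Nat # \<Gamma>) (lift ` H') (Con Succ \<cdot> (acc_tm \<cdot> Var 1 \<cdot> (Con Succ \<cdot> Var 0)))"
      by (simp add: has_type_iff)
    then show "derivable Th (Nat # \<Gamma>) H' (inst 1 (Con Succ \<cdot> Var 0) ?A)"
      by (auto simp: inst_def val_simps intro!: derivable.allI ctx.derivable_EqI)
  qed (auto simp: has_type_iff)
  from val_All[OF this[simplified inst_def fsub.simps], of l] show ?thesis
    by (simp add: has_type_iff val_App)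
qed

lemma acc_Zero_right:
  assumes "vty n = Some Nat"
  shows "\<langle>acc_tm\<rangle> \<bullet> n \<bullet> \<langle>Con Zero\<rangle> = n"
proof -
  obtain k where [simp]: "n = \<langle>k\<rangle>" "tyof \<Gamma> k = Some Nat"
    using assms[THEN vtyD] by auto
  let ?A = "Eq Nat (acc_tm \<cdot> Var 0 \<cdot> Con Zero) (Var 0)"
  have "derivable Th \<Gamma> H (inst 0 k ?A)"
  proof (rule nat_induct_derivable)
    show "derivable Th \<Gamma> H (inst 0 (Con Zero) ?A)"
      by (auto simp: inst_def val_simps intro!: ctx.derivable_EqI)
    fix H' assume "?A \<in> H'"
    then have "ctx.val (Nat # \<Gamma>) H' (acc_tm \<cdot> Var 0 \<cdot> Con Zero) = ctx.val (Nat # \<Gamma>) H' (Var 0)"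
      by (rule ctx.val_hyp) auto
    then show "derivable Th (Nat # \<Gamma>) H' (inst 1 (Con Succ \<cdot> Var 0) ?A)"
      by (auto simp: inst_def val_simps ctx.acc_Succ_right intro!: ctx.derivable_EqI)
  qed (auto simp: has_type_iff)
  then show ?thesis
    by (simp add: inst_def flip: val_App) (rule val_eqI_derivable[of Nat], simp_all)
qed

text \<open>Position \<open>n + m\<close> of a stream starting with a prefix of length
  \<open>n\<close> is position \<open>m\<close> of the rest. In the induction on \<open>n\<close>
  both \<delta> and \<open>m\<close> vary, since the step uses the hypothesis at the stream
  \<open>\<alpha>(n) * \<delta>\<close> and at \<open>m + 1\<close>; the recursion of
  \<open>acc_tm\<close> matches this shift.\<close>

lemma append_prefix_acc:
  assumes "vty \<alpha> = Some (Stream X)" "vty n = Some Nat" "vty \<delta> = Some (Stream X)" "vty m = Some Nat"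
  shows "\<langle>append_tm X\<rangle> \<bullet> (\<langle>prefix_tm X\<rangle> \<bullet> \<alpha> \<bullet> n) \<bullet> \<delta> \<bullet> (\<langle>acc_tm\<rangle> \<bullet> n \<bullet> m) = \<delta> \<bullet> m"
proof -
  obtain a k d l where [simp]: "\<alpha> = \<langle>a\<rangle>" "n = \<langle>k\<rangle>" "\<delta> = \<langle>d\<rangle>" "m = \<langle>l\<rangle>"
    "tyof \<Gamma> a = Some (Stream X)" "tyof \<Gamma> k = Some Nat" "tyof \<Gamma> d = Some (Stream X)" "tyof \<Gamma> l = Some Nat"
    using assms[THEN vtyD] by auto
  let ?a = "ren Suc (ren Suc (ren Suc a))"
  let ?A = "All (Stream X) (All Nat (Eq X
    (append_tm X \<cdot> (prefix_tm X \<cdot> ?a \<cdot> Var 2) \<cdot> Var 1 \<cdot> (acc_tm \<cdot> Var 2 \<cdot> Var 0)) (Var 1 \<cdot> Var 0)))"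
  have "derivable Th \<Gamma> H (inst 0 k ?A)"
  proof (rule nat_induct_derivable)
    show "derivable Th \<Gamma> H (inst 0 (Con Zero) ?A)"
      by (auto simp: inst_def val_simps intro!: derivable.allI ctx.derivable_EqI)
    fix H' assume "?A \<in> H'"
    then have "lift (lift ?A) \<in> lift ` lift ` H'" by (intro imageI)
    then have "derivable Th (Nat # Stream X # Nat # \<Gamma>) (lift ` lift ` H') (lift (lift ?A))"
      by (rule derivable.hyp) (simp add: has_type_iff)
    from ctx.val_All2[OF this[simplified], of "cons_tm X \<cdot> (?a \<cdot> Var 2) \<cdot> Var 1" "Con Succ \<cdot> Var 0"]
    have "ctx.val (Nat # Stream X # Nat # \<Gamma>) (lift ` lift ` H')
        (append_tm X \<cdot> (prefix_tm X \<cdot> ?a \<cdot> Var 2) \<cdot> (cons_tm X \<cdot> (?a \<cdot> Var 2) \<cdot> Var 1) \<cdot> (acc_tm \<cdot> Var 2 \<cdot> (Con Succ \<cdot> Var 0)))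
      = ctx.val (Nat # Stream X # Nat # \<Gamma>) (lift ` lift ` H')
        (cons_tm X \<cdot> (?a \<cdot> Var 2) \<cdot> Var 1 \<cdot> (Con Succ \<cdot> Var 0))"
      by (simp add: has_type_iff numeral_2_eq_2)
    then show "derivable Th (Nat # \<Gamma>) H' (inst 1 (Con Succ \<cdot> Var 0) ?A)"
      by (auto simp: inst_def val_simps numeral_2_eq_2 intro!: derivable.allI ctx.derivable_EqI)
  qed (auto simp: has_type_iff)
  from val_All2[OF this[simplified inst_def fsub.simps], of d l] show ?thesis
    by (simp add: has_type_iff val_App)
qed

lemma append_prefix_nth:
  assumes "vty \<alpha> = Some (Stream X)" "vty n = Some Nat" "vty \<delta> = Some (Stream X)"
  shows "\<langle>append_tm X\<rangle> \<bullet> (\<langle>prefix_tm X\<rangle> \<bullet> \<alpha> \<bullet> n) \<bullet> \<delta> \<bullet> n = \<delta> \<bullet> \<langle>Con Zero\<rangle>"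
  using append_prefix_acc[OF assms, of "\<langle>Con Zero\<rangle>"] assms by (simp add: acc_Zero_right vty_val)

text \<open>Makes continuity applicable to extensions of a prefix. Induction on \<open>n\<close>
  with \<beta> varying: the hypothesis is used at \<open>\<alpha>(n) * \<beta>\<close>, and
  \<open>append_prefix_nth\<close> identifies the last entry.\<close>

lemma prefix_append_prefix:
  assumes "vty \<alpha> = Some (Stream X)" "vty n = Some Nat" "vty \<beta> = Some (Stream X)"
  shows "\<langle>prefix_tm X\<rangle> \<bullet> (\<langle>append_tm X\<rangle> \<bullet> (\<langle>prefix_tm X\<rangle> \<bullet> \<alpha> \<bullet> n) \<bullet> \<beta>) \<bullet> n = \<langle>prefix_tm X\<rangle> \<bullet> \<alpha> \<bullet> n"
proof -
  obtain a k b where [simp]: "\<alpha> = \<langle>a\<rangle>" "n = \<langle>k\<rangle>" "\<beta> = \<langle>b\<rangle>"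
    "tyof \<Gamma> a = Some (Stream X)" "tyof \<Gamma> k = Some Nat" "tyof \<Gamma> b = Some (Stream X)"
    using assms[THEN vtyD] by auto
  let ?a = "ren Suc (ren Suc a)"
  let ?A = "All (Stream X) (Eq (Seq X)
    (prefix_tm X \<cdot> (append_tm X \<cdot> (prefix_tm X \<cdot> ?a \<cdot> Var 1) \<cdot> Var 0) \<cdot> Var 1) (prefix_tm X \<cdot> ?a \<cdot> Var 1))"
  have "derivable Th \<Gamma> H (inst 0 k ?A)"
  proof (rule nat_induct_derivable)
    show "derivable Th \<Gamma> H (inst 0 (Con Zero) ?A)"
      by (auto simp: inst_def val_simps intro!: derivable.allI ctx.derivable_EqI)
    fix H' assume "?A \<in> H'"
    then have "lift ?A \<in> lift ` H'" by (intro imageI)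
    then have "derivable Th (Stream X # Nat # \<Gamma>) (lift ` H') (lift ?A)"
      by (rule derivable.hyp) (simp add: has_type_iff)
    from ctx.val_All[OF this[simplified], of "cons_tm X \<cdot> (?a \<cdot> Var 1) \<cdot> Var 0"]
    have "ctx.val (Stream X # Nat # \<Gamma>) (lift ` H')
        (prefix_tm X \<cdot> (append_tm X \<cdot> (prefix_tm X \<cdot> ?a \<cdot> Var 1) \<cdot> (cons_tm X \<cdot> (?a \<cdot> Var 1) \<cdot> Var 0)) \<cdot> Var 1)
      = ctx.val (Stream X # Nat # \<Gamma>) (lift ` H') (prefix_tm X \<cdot> ?a \<cdot> Var 1)"
      by (simp add: has_type_iff)
    then show "derivable Th (Nat # \<Gamma>) H' (inst 1 (Con Succ \<cdot> Var 0) ?A)"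
      by (auto simp: inst_def val_simps ctx.append_prefix_nth intro!: derivable.allI ctx.derivable_EqI)
  qed (auto simp: has_type_iff)
  from val_All[OF this[simplified inst_def fsub.simps], of b] show ?thesis
    by (simp add: has_type_iff val_App)
qed

text \<open>Induction on \<open>u\<close> with \<alpha> varying, because the last entry
  \<open>x\<close> of \<open>u\<close> moves into the stream \<open>x * \<alpha>\<close>.\<close>

lemma append_concat:
  assumes "vty s = Some (Seq X)" "vty u = Some (Seq X)" "vty \<alpha> = Some (Stream X)"
  shows "\<langle>append_tm X\<rangle> \<bullet> (\<langle>concat_tm X\<rangle> \<bullet> s \<bullet> u) \<bullet> \<alpha> = \<langle>append_tm X\<rangle> \<bullet> s \<bullet> (\<langle>append_tm X\<rangle> \<bullet> u \<bullet> \<alpha>)"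
proof -
  obtain t v a where [simp]: "s = \<langle>t\<rangle>" "u = \<langle>v\<rangle>" "\<alpha> = \<langle>a\<rangle>"
    "tyof \<Gamma> t = Some (Seq X)" "tyof \<Gamma> v = Some (Seq X)" "tyof \<Gamma> a = Some (Stream X)"
    using assms[THEN vtyD] by auto
  let ?t = "ren Suc (ren Suc t)"
  let ?A = "All (Stream X) (Eq (Stream X)
    (append_tm X \<cdot> (concat_tm X \<cdot> ?t \<cdot> Var 1) \<cdot> Var 0) (append_tm X \<cdot> ?t \<cdot> (append_tm X \<cdot> Var 1 \<cdot> Var 0)))"
  have "derivable Th \<Gamma> H (inst 0 v ?A)"
  proof (rule seq_induct_derivable)
    show "derivable Th \<Gamma> H (inst 0 (Con (Empty X)) ?A)"
      by (auto simp: inst_def val_simps intro!: derivable.allI ctx.derivable_EqI)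
    fix H' assume "lift ?A \<in> H'"
    then have "lift (lift ?A) \<in> lift ` H'" by (intro imageI)
    then have "derivable Th (Stream X # X # Seq X # \<Gamma>) (lift ` H') (lift (lift ?A))"
      by (rule derivable.hyp) (simp add: has_type_iff)
    from ctx.val_All[OF this[simplified], of "cons_tm X \<cdot> Var 1 \<cdot> Var 0"]
    have "ctx.val (Stream X # X # Seq X # \<Gamma>) (lift ` H')
        (append_tm X \<cdot> (concat_tm X \<cdot> ren Suc ?t \<cdot> Var 2) \<cdot> (cons_tm X \<cdot> Var 1 \<cdot> Var 0))
      = ctx.val (Stream X # X # Seq X # \<Gamma>) (lift ` H')
        (append_tm X \<cdot> ren Suc ?t \<cdot> (append_tm X \<cdot> Var 2 \<cdot> (cons_tm X \<cdot> Var 1 \<cdot> Var 0)))"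
      by (simp add: has_type_iff numeral_2_eq_2)
    then show "derivable Th (X # Seq X # \<Gamma>) H' (inst 2 (Con (Snoc X) \<cdot> Var 1 \<cdot> Var 0) ?A)"
      by (auto simp: inst_def val_simps numeral_2_eq_2 intro!: derivable.allI ctx.derivable_EqI)
  qed (auto simp: has_type_iff)
  from val_All[OF this[simplified inst_def fsub.simps], of a] show ?thesis
    by (simp add: has_type_iff val_App)
qed

text \<open>Identifies the index \<open>s * (x * u)\<close>, at which the selection shifted by
  \<open>s\<close> is evaluated, with the index \<open>(s * x) * u\<close> of the selection shifted
  by \<open>s * x\<close>. Induction on \<open>u\<close>.\<close>

lemma concat_concat_singleton:
  assumes "vty s = Some (Seq X)" "vty x = Some X" "vty u = Some (Seq X)"
  shows "\<langle>concat_tm X\<rangle> \<bullet> s \<bullet> (\<langle>concat_tm X\<rangle> \<bullet> (\<langle>Con (Snoc X)\<rangle> \<bullet> \<langle>Con (Empty X)\<rangle> \<bullet> x) \<bullet> u) =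
    \<langle>concat_tm X\<rangle> \<bullet> (\<langle>Con (Snoc X)\<rangle> \<bullet> s \<bullet> x) \<bullet> u"
proof -
  obtain t y v where [simp]: "s = \<langle>t\<rangle>" "x = \<langle>y\<rangle>" "u = \<langle>v\<rangle>"
    "tyof \<Gamma> t = Some (Seq X)" "tyof \<Gamma> y = Some X" "tyof \<Gamma> v = Some (Seq X)"
    using assms[THEN vtyD] by auto
  let ?A = "Eq (Seq X)
    (concat_tm X \<cdot> ren Suc t \<cdot> (concat_tm X \<cdot> (Con (Snoc X) \<cdot> Con (Empty X) \<cdot> ren Suc y) \<cdot> Var 0))
    (concat_tm X \<cdot> (Con (Snoc X) \<cdot> ren Suc t \<cdot> ren Suc y) \<cdot> Var 0)"
  have "derivable Th \<Gamma> H (inst 0 v ?A)"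
  proof (rule seq_induct_derivable)
    show "derivable Th \<Gamma> H (inst 0 (Con (Empty X)) ?A)"
      by (auto simp: inst_def val_simps intro!: ctx.derivable_EqI)
    fix H' assume "lift ?A \<in> H'"
    from ctx.val_hyp[OF this[simplified], of "X # Seq X # \<Gamma>"]
    show "derivable Th (X # Seq X # \<Gamma>) H' (inst 2 (Con (Snoc X) \<cdot> Var 1 \<cdot> Var 0) ?A)"
      by (auto simp: inst_def val_simps intro!: ctx.derivable_EqI)
  qed (auto simp: has_type_iff)
  then show ?thesis
    by (simp add: inst_def flip: val_App) (rule val_eqI_derivable[of "Seq X"], simp_all)
qed

end

section \<open>The two functionals\<close>

text \<open>Lets the defining equation be carried under binders: a lifted hypothesis is again the
  equation, for the weakened functional.\<close>

lemma lift_inst_MBR_eq: "lift (inst 0 F (MBR_eq (X, R))) = inst 0 (ren Suc F) (MBR_eq (X, R))"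
  by (simp add: inst_def MBR_eq_def)

lemma lift_inst_MBR'_eq: "lift (inst 0 F (MBR'_eq (X, R))) = inst 0 (ren Suc F) (MBR'_eq (X, R))"
  by (simp add: inst_def MBR'_eq_def)

context ctx
begin

text \<open>Compatibility with abstraction: by extensionality it suffices to apply both weakened
  abstractions to the fresh variable and to beta-reduce.\<close>

lemma val_Lam:
  assumes "ctx.val (\<sigma> # \<Gamma>) (lift ` H) t = ctx.val (\<sigma> # \<Gamma>) (lift ` H) t'" "tyof (\<sigma> # \<Gamma>) t = Some \<tau>"
  shows "\<langle>Lam \<sigma> t\<rangle> = \<langle>Lam \<sigma> t'\<rangle>"
proof -
  have ty: "tyof (\<sigma> # \<Gamma>) t' = Some \<tau>"
    using ctx.tyof_cong[OF assms(1)] assms(2) by simp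
  have beta: "ctx.val (\<sigma> # \<Gamma>) (lift ` H) (ren Suc (Lam \<sigma> u) \<cdot> Var 0) = ctx.val (\<sigma> # \<Gamma>) (lift ` H) u"
    if "tyof (\<sigma> # \<Gamma>) u = Some \<tau>" for u
  proof -
    \<comment> \<open>Weakening under the binder followed by putting the fresh variable for the
      bound one is the identity.\<close>
    have "(\<lambda>i. case_nat (Var 0) Var (case_nat 0 (\<lambda>i. Suc (Suc i)) i)) = Var"
      by (auto split: nat.split)
    then have *: "sub (case_nat (Var 0) Var) (ren (case_nat 0 (\<lambda>i. Suc (Suc i))) u) = u"
      by (simp add: sub_ren)
    have "tyof (\<sigma> # \<Gamma>) (ren Suc (Lam \<sigma> u)) = Some (\<sigma> \<rightarrow> \<tau>)"
      using that by (subst tyof_ren_Suc) simp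
    then show ?thesis
      using ctx.val_beta[of "\<sigma> # \<Gamma>" \<sigma> "ren (case_nat 0 (\<lambda>i. Suc (Suc i))) u" "Var 0"] * by simp
  qed
  show ?thesis
    by (rule val_ext[of _ \<sigma> \<tau>]) (use assms ty beta[OF ty] beta[OF assms(2)] in simp_all)
qed

text \<open>Both functions send \<alpha> to \<open>q(s * (x * \<alpha>))\<close>, by the recursion
  of \<open>append_tm\<close> at \<open>s * x\<close>.\<close>

lemma section_fsection:
  assumes "vty q = Some (Stream X \<rightarrow> R)" "vty s = Some (Seq X)" "vty x = Some X"
  shows "\<langle>section_tm X R\<rangle> \<bullet> (\<langle>fsection_tm X R\<rangle> \<bullet> q \<bullet> s) \<bullet> x = \<langle>fsection_tm X R\<rangle> \<bullet> q \<bullet> (\<langle>Con (Snoc X)\<rangle> \<bullet> s \<bullet> x)"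
proof -
  obtain f t y where [simp]: "q = \<langle>f\<rangle>" "s = \<langle>t\<rangle>" "x = \<langle>y\<rangle>"
    "tyof \<Gamma> f = Some (Stream X \<rightarrow> R)" "tyof \<Gamma> t = Some (Seq X)" "tyof \<Gamma> y = Some X"
    using assms[THEN vtyD] by auto
  have "\<langle>section_tm X R \<cdot> (fsection_tm X R \<cdot> f \<cdot> t) \<cdot> y\<rangle> = \<langle>fsection_tm X R \<cdot> f \<cdot> (Con (Snoc X) \<cdot> t \<cdot> y)\<rangle>"
    by (rule val_ext[of _ "Stream X" R]) (simp_all add: val_simps)
  then show ?thesis by (simp add: val_App)
qed

text \<open>The defining equation, available as a hypothesis, becomes an equality of classes at
  given arguments: \<open>allE\<close> removes the outer two quantifiers and \<open>val_All\<close>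
  the innermost.\<close>

lemma val_MBR:
  assumes "inst 0 F (MBR_eq (X, R)) \<in> H" "tyof \<Gamma> F = Some (bar_rec_type (X, R))"
    and "tyof \<Gamma> s = Some (Seq X)" "tyof \<Gamma> \<epsilon> = Some (Sel X R)" "tyof \<Gamma> q = Some (Stream X \<rightarrow> R)"
  shows "\<langle>F \<cdot> s \<cdot> \<epsilon> \<cdot> q\<rangle> = \<langle>\<epsilon> \<cdot> s \<cdot> Lam X (section_tm X R \<cdot> ren Suc q \<cdot> Var 0
    \<cdot> (ren Suc F \<cdot> (Con (Snoc X) \<cdot> ren Suc s \<cdot> Var 0) \<cdot> ren Suc \<epsilon> \<cdot> (section_tm X R \<cdot> ren Suc q \<cdot> Var 0)))\<rangle>"
proof -
  note [simp] = assms(2-)[unfolded bar_rec_type_def prod.case]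
  have "derivable Th \<Gamma> H (inst 0 F (MBR_eq (X, R)))"
    by (rule derivable.hyp[OF assms(1)]) (simp add: inst_def MBR_eq_def has_type_iff)
  from derivable.allE[OF this[unfolded inst_def MBR_eq_def prod.case fsub.simps], of s]
  have "derivable Th \<Gamma> H (inst 0 s (fsub (up (case_nat F (\<lambda>i. Var (0 + i))))
      (All (Sel X R) (All (Stream X \<rightarrow> R)
       (Eq (Stream X)
          (Var 3 \<cdot> Var 2 \<cdot> Var 1 \<cdot> Var 0)
          (Var 1 \<cdot> Var 2 \<cdot> Lam X
             ((section_tm X R \<cdot> Var 1 \<cdot> Var 0)
              \<cdot> (Var 4 \<cdot> (Con (Snoc X) \<cdot> Var 3 \<cdot> Var 0) \<cdot> Var 2
                   \<cdot> (section_tm X R \<cdot> Var 1 \<cdot> Var 0)))))))))"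
    by (simp add: has_type_iff)
  from derivable.allE[OF this[unfolded inst_def fsub.simps], of \<epsilon>]
  have "derivable Th \<Gamma> H (All (Stream X \<rightarrow> R) (Eq (Stream X) (ren Suc (F \<cdot> s \<cdot> \<epsilon>) \<cdot> Var 0)
     (ren Suc (\<epsilon> \<cdot> s) \<cdot> Lam X (section_tm X R \<cdot> Var 1 \<cdot> Var 0
    \<cdot> (ren Suc (ren Suc F) \<cdot> (Con (Snoc X) \<cdot> ren Suc (ren Suc s) \<cdot> Var 0) \<cdot> ren Suc (ren Suc \<epsilon>)
      \<cdot> (section_tm X R \<cdot> Var 1 \<cdot> Var 0))))))"
    by (simp add: has_type_iff inst_def)
  from val_All[OF this, of q] show ?thesis by (simp add: has_type_iff)
qed

lemma val_MBR':
  assumes "inst 0 F (MBR'_eq (X, R)) \<in> H" "tyof \<Gamma> F = Some (bar_rec_type (X, R))"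
    and "tyof \<Gamma> s = Some (Seq X)" "tyof \<Gamma> \<epsilon> = Some (Sel X R)" "tyof \<Gamma> q = Some (Stream X \<rightarrow> R)"
  shows "\<langle>F \<cdot> s \<cdot> \<epsilon> \<cdot> q\<rangle> = \<langle>append_tm X \<cdot> s \<cdot> (\<epsilon> \<cdot> s \<cdot> Lam X (ren Suc q
    \<cdot> (ren Suc F \<cdot> (Con (Snoc X) \<cdot> ren Suc s \<cdot> Var 0) \<cdot> ren Suc \<epsilon> \<cdot> ren Suc q)))\<rangle>"
proof -
  note [simp] = assms(2-)[unfolded bar_rec_type_def prod.case]
  have "derivable Th \<Gamma> H (inst 0 F (MBR'_eq (X, R)))"
    by (rule derivable.hyp[OF assms(1)]) (simp add: inst_def MBR'_eq_def has_type_iff)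
  from derivable.allE[OF this[unfolded inst_def MBR'_eq_def prod.case fsub.simps], of s]
  have "derivable Th \<Gamma> H (inst 0 s (fsub (up (case_nat F (\<lambda>i. Var (0 + i))))
      (All (Sel X R) (All (Stream X \<rightarrow> R)
       (Eq (Stream X)
          (Var 3 \<cdot> Var 2 \<cdot> Var 1 \<cdot> Var 0)
          (append_tm X \<cdot> Var 2 \<cdot> (Var 1 \<cdot> Var 2 \<cdot> Lam X
             (Var 1 \<cdot> (Var 4 \<cdot> (Con (Snoc X) \<cdot> Var 3 \<cdot> Var 0) \<cdot> Var 2 \<cdot> Var 1)))))))))"
    by (simp add: has_type_iff)
  from derivable.allE[OF this[unfolded inst_def fsub.simps], of \<epsilon>]
  have "derivable Th \<Gamma> H (All (Stream X \<rightarrow> R) (Eq (Stream X) (ren Suc (F \<cdot> s \<cdot> \<epsilon>) \<cdot> Var 0)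
     (append_tm X \<cdot> ren Suc s \<cdot> (ren Suc (\<epsilon> \<cdot> s) \<cdot> Lam X (Var 1
    \<cdot> (ren Suc (ren Suc F) \<cdot> (Con (Snoc X) \<cdot> ren Suc (ren Suc s) \<cdot> Var 0) \<cdot> ren Suc (ren Suc \<epsilon>) \<cdot> Var 1))))))"
    by (simp add: has_type_iff inst_def)
  from val_All[OF this, of q] show ?thesis by (simp add: has_type_iff)
qed

end


section \<open>Defining \<open>MBR'\<close> from \<open>MBR\<close>\<close>

text \<open>\<open>\<lambda>F s \<epsilon> q. s * F\<^sub>s(\<epsilon>)(q\<^sub>s)\<close>\<close>
definition MBR'_of_MBR :: "ty \<Rightarrow> ty \<Rightarrow> tm" where
  "MBR'_of_MBR X R = Lam (bar_rec_type (X, R)) (Lam (Seq X) (Lam (Sel X R) (Lam (Stream X \<rightarrow> R)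
     (append_tm X \<cdot> Var 2 \<cdot> (Var 3 \<cdot> Var 2 \<cdot> Var 1 \<cdot> (fsection_tm X R \<cdot> Var 0 \<cdot> Var 2))))))"

lemma MBR'_of_MBR_simps [simp]:
  "tyof \<Gamma> (MBR'_of_MBR X R) = Some (bar_rec_type (X, R) \<rightarrow> bar_rec_type (X, R))"
  "sub \<theta> (MBR'_of_MBR X R) = MBR'_of_MBR X R" "ren \<rho> (MBR'_of_MBR X R) = MBR'_of_MBR X R"
  by (simp_all add: MBR'_of_MBR_def bar_rec_type_def)

context ctx
begin

lemma ap_MBR'_of_MBR:
  assumes "vty F = Some (bar_rec_type (X, R))" "vty s = Some (Seq X)"
    and "vty \<epsilon> = Some (Sel X R)" "vty q = Some (Stream X \<rightarrow> R)"
  shows "\<langle>MBR'_of_MBR X R\<rangle> \<bullet> F \<bullet> s \<bullet> \<epsilon> \<bullet> q =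
    \<langle>append_tm X\<rangle> \<bullet> s \<bullet> (F \<bullet> s \<bullet> \<epsilon> \<bullet> (\<langle>fsection_tm X R\<rangle> \<bullet> q \<bullet> s))"
  using assms[THEN vtyD]
  by (auto simp: MBR'_of_MBR_def bar_rec_type_def head_reduce simp flip: val_App)

text \<open>The equation of \<open>F\<close> is used at \<open>q_s\<close>. With
  \<open>r = q_{s*x}\<close> the function there has the value \<open>r(F_{s*x}(\<epsilon>)(r)) =
  q((s * x) * F_{s*x}(\<epsilon>)(r))\<close>, which is
  \<open>q(G_{s*x}(\<epsilon>)(q))\<close>.\<close>

lemma val_MBR'_of_MBR:
  assumes F: "inst 0 F (MBR_eq (X, R)) \<in> H" "tyof \<Gamma> F = Some (bar_rec_type (X, R))"
    and "tyof \<Gamma> s = Some (Seq X)" "tyof \<Gamma> \<epsilon> = Some (Sel X R)" "tyof \<Gamma> q = Some (Stream X \<rightarrow> R)"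
  defines "G \<equiv> MBR'_of_MBR X R \<cdot> F"
  shows "\<langle>G \<cdot> s \<cdot> \<epsilon> \<cdot> q\<rangle> = \<langle>append_tm X \<cdot> s \<cdot> (\<epsilon> \<cdot> s \<cdot> Lam X (ren Suc q
    \<cdot> (ren Suc G \<cdot> (Con (Snoc X) \<cdot> ren Suc s \<cdot> Var 0) \<cdot> ren Suc \<epsilon> \<cdot> ren Suc q)))\<rangle>"
proof -
  note [simp] = assms(2-5)
  let ?q = "fsection_tm X R \<cdot> q \<cdot> s"
  let ?b = "section_tm X R \<cdot> ren Suc ?q \<cdot> Var 0
    \<cdot> (ren Suc F \<cdot> (Con (Snoc X) \<cdot> ren Suc s \<cdot> Var 0) \<cdot> ren Suc \<epsilon> \<cdot> (section_tm X R \<cdot> ren Suc ?q \<cdot> Var 0))"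
  let ?b' = "ren Suc q \<cdot> (ren Suc G \<cdot> (Con (Snoc X) \<cdot> ren Suc s \<cdot> Var 0) \<cdot> ren Suc \<epsilon> \<cdot> ren Suc q)"
  have "\<langle>Lam X ?b\<rangle> = \<langle>Lam X ?b'\<rangle>"
  proof (rule val_Lam)
    show "ctx.val (X # \<Gamma>) (lift ` H) ?b = ctx.val (X # \<Gamma>) (lift ` H) ?b'"
      by (simp add: G_def val_simps ctx.section_fsection ctx.ap_MBR'_of_MBR bar_rec_type_def)
    show "tyof (X # \<Gamma>) ?b = Some R" by (simp add: bar_rec_type_def)
  qed
  moreover have "\<langle>F \<cdot> s \<cdot> \<epsilon> \<cdot> ?q\<rangle> = \<langle>\<epsilon> \<cdot> s \<cdot> Lam X ?b\<rangle>"
    by (rule val_MBR) (simp_all add: F)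
  ultimately show ?thesis
    by (simp add: G_def val_App vty_val vty_ap ap_MBR'_of_MBR)
qed

end

lemma derivable_MBR'_of_MBR:
  "derivable Th [bar_rec_type (X, R)] {MBR_eq (X, R)} (inst 1 (MBR'_of_MBR X R \<cdot> Var 0) (MBR'_eq (X, R)))"
proof -
  let ?\<Gamma> = "[Stream X \<rightarrow> R, Sel X R, Seq X, bar_rec_type (X, R)]"
  let ?H = "lift ` lift ` lift ` {MBR_eq (X, R)}"
  \<comment> \<open>Written in this form, the hypothesis follows the functional through the three
    quantifiers, from index 0 to index 3.\<close>
  have "MBR_eq (X, R) = inst 0 (Var 0) (MBR_eq (X, R))"
    by (simp add: MBR_eq_def inst_def)
  then have "?H = {inst 0 (Var 3) (MBR_eq (X, R))}"
    by (metis (no_types, lifting) image_empty image_insert lift_inst_MBR_eq ren.simps(1) numeral_3_eq_3)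
  then have "inst 0 (Var 3) (MBR_eq (X, R)) \<in> ?H" by simp
  from ctx.val_MBR'_of_MBR[OF this, of ?\<Gamma> "Var 2" "Var 1" "Var 0"] show ?thesis
    by (auto simp: inst_def MBR'_eq_def bar_rec_type_def eval_nat_numeral intro!: derivable.allI ctx.derivable_EqI)
qed


section \<open>Defining \<open>MBR\<close> from \<open>MBR'\<close>\<close>

text \<open>\<open>\<lambda>G s \<epsilon> q. G\<^sub>\<langle>\<^sub>\<rangle>(\<lambda>u. \<epsilon>\<^sub>s\<^sub>*\<^sub>u)(q)\<close>\<close>
definition MBR_of_MBR' :: "ty \<Rightarrow> ty \<Rightarrow> tm" where
  "MBR_of_MBR' X R = Lam (bar_rec_type (X, R)) (Lam (Seq X) (Lam (Sel X R) (Lam (Stream X \<rightarrow> R)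
     (Var 3 \<cdot> Con (Empty X) \<cdot> (shift_tm X R \<cdot> Var 1 \<cdot> Var 2) \<cdot> Var 0))))"

lemma MBR_of_MBR'_simps [simp]:
  "tyof \<Gamma> (MBR_of_MBR' X R) = Some (bar_rec_type (X, R) \<rightarrow> bar_rec_type (X, R))"
  "sub \<theta> (MBR_of_MBR' X R) = MBR_of_MBR' X R" "ren \<rho> (MBR_of_MBR' X R) = MBR_of_MBR' X R"
  by (simp_all add: MBR_of_MBR'_def bar_rec_type_def)

text \<open>\<open>G\<^sub>x\<^sub>*\<^sub>u(\<lambda>v. \<epsilon>\<^sub>s\<^sub>*\<^sub>v)(q)\<close> and \<open>x * G\<^sub>u(\<lambda>v. \<epsilon>\<^sub>s\<^sub>*\<^sub>x\<^sub>*\<^sub>v)(q\<^sub>x)\<close>, which agree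
  if \<open>G\<close> satisfies the equation of \<open>MBR'\<close>\<close>
definition lhs_tm :: "ty \<Rightarrow> ty \<Rightarrow> tm \<Rightarrow> tm \<Rightarrow> tm \<Rightarrow> tm \<Rightarrow> tm \<Rightarrow> tm \<Rightarrow> tm" where
  "lhs_tm X R G s \<epsilon> q x u =
     G \<cdot> (concat_tm X \<cdot> (Con (Snoc X) \<cdot> Con (Empty X) \<cdot> x) \<cdot> u) \<cdot> (shift_tm X R \<cdot> \<epsilon> \<cdot> s) \<cdot> q"

definition rhs_tm :: "ty \<Rightarrow> ty \<Rightarrow> tm \<Rightarrow> tm \<Rightarrow> tm \<Rightarrow> tm \<Rightarrow> tm \<Rightarrow> tm \<Rightarrow> tm" where
  "rhs_tm X R G s \<epsilon> q x u =
     cons_tm X \<cdot> x \<cdot> (G \<cdot> u \<cdot> (shift_tm X R \<cdot> \<epsilon> \<cdot> (Con (Snoc X) \<cdot> s \<cdot> x)) \<cdot> (section_tm X R \<cdot> q \<cdot> x))"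

lemma ren_lhs_rhs [simp]:
  "ren \<rho> (lhs_tm X R G s \<epsilon> q x u) = lhs_tm X R (ren \<rho> G) (ren \<rho> s) (ren \<rho> \<epsilon>) (ren \<rho> q) (ren \<rho> x) (ren \<rho> u)"
  "ren \<rho> (rhs_tm X R G s \<epsilon> q x u) = rhs_tm X R (ren \<rho> G) (ren \<rho> s) (ren \<rho> \<epsilon>) (ren \<rho> q) (ren \<rho> x) (ren \<rho> u)"
  "sub \<theta> (lhs_tm X R G s \<epsilon> q x u) = lhs_tm X R (sub \<theta> G) (sub \<theta> s) (sub \<theta> \<epsilon>) (sub \<theta> q) (sub \<theta> x) (sub \<theta> u)"
  "sub \<theta> (rhs_tm X R G s \<epsilon> q x u) = rhs_tm X R (sub \<theta> G) (sub \<theta> s) (sub \<theta> \<epsilon>) (sub \<theta> q) (sub \<theta> x) (sub \<theta> u)"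
  by (simp_all add: lhs_tm_def rhs_tm_def)

section \<open>Consequences of continuity and of the equation of \<open>MBR'\<close>\<close>

context ctx
begin

lemma ap_MBR_of_MBR':
  assumes "vty G = Some (bar_rec_type (X, R))" "vty s = Some (Seq X)"
    and "vty \<epsilon> = Some (Sel X R)" "vty q = Some (Stream X \<rightarrow> R)"
  shows "\<langle>MBR_of_MBR' X R\<rangle> \<bullet> G \<bullet> s \<bullet> \<epsilon> \<bullet> q = G \<bullet> \<langle>Con (Empty X)\<rangle> \<bullet> (\<langle>shift_tm X R\<rangle> \<bullet> \<epsilon> \<bullet> s) \<bullet> q"
  using assms[THEN vtyD]
  by (auto simp: MBR_of_MBR'_def bar_rec_type_def head_reduce simp flip: val_App)

text \<open>The hypothesis says that \<open>n\<close> is a modulus of continuity of \<open>r\<close>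
  at \<open>a\<close>. It is applied to the stream \<open>[a](n) * \<beta>\<close>, which agrees
  with \<open>a\<close> up to \<open>n\<close> by \<open>prefix_append_prefix\<close>.\<close>

lemma cont_append_prefix:
  assumes "All (Stream X) (Eq (Seq X) (prefix_tm X \<cdot> ren Suc a \<cdot> ren Suc n) (prefix_tm X \<cdot> Var 0 \<cdot> ren Suc n) \<^bold>\<longrightarrow>
      Eq R (ren Suc r \<cdot> ren Suc a) (ren Suc r \<cdot> Var 0)) \<in> H"
    and "tyof \<Gamma> a = Some (Stream X)" "tyof \<Gamma> n = Some Nat" "tyof \<Gamma> r = Some (Stream X \<rightarrow> R)"
    and "vty \<beta> = Some (Stream X)"
  shows "\<langle>r\<rangle> \<bullet> (\<langle>append_tm X\<rangle> \<bullet> (\<langle>prefix_tm X\<rangle> \<bullet> \<langle>a\<rangle> \<bullet> \<langle>n\<rangle>) \<bullet> \<beta>) = \<langle>r\<rangle> \<bullet> \<langle>a\<rangle>"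
proof -
  note [simp] = assms(2-4)
  obtain b where [simp]: "\<beta> = \<langle>b\<rangle>" "tyof \<Gamma> b = Some (Stream X)"
    using assms(5)[THEN vtyD] by auto
  let ?b = "append_tm X \<cdot> (prefix_tm X \<cdot> a \<cdot> n) \<cdot> b"
  have "derivable Th \<Gamma> H (All (Stream X) (Eq (Seq X) (prefix_tm X \<cdot> ren Suc a \<cdot> ren Suc n) (prefix_tm X \<cdot> Var 0 \<cdot> ren Suc n) \<^bold>\<longrightarrow>
      Eq R (ren Suc r \<cdot> ren Suc a) (ren Suc r \<cdot> Var 0)))"
    by (rule derivable.hyp[OF assms(1)]) (simp add: has_type_iff)
  from derivable.allE[OF this, of ?b]
  have "derivable Th \<Gamma> H (Eq (Seq X) (prefix_tm X \<cdot> a \<cdot> n) (prefix_tm X \<cdot> ?b \<cdot> n) \<^bold>\<longrightarrow> Eq R (r \<cdot> a) (r \<cdot> ?b))"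
    by (simp add: has_type_iff inst_def)
  moreover have "derivable Th \<Gamma> H (Eq (Seq X) (prefix_tm X \<cdot> a \<cdot> n) (prefix_tm X \<cdot> ?b \<cdot> n))"
    by (rule derivable_EqI) (simp_all add: val_App vty_val prefix_append_prefix)
  ultimately have "derivable Th \<Gamma> H (Eq R (r \<cdot> a) (r \<cdot> ?b))"
    by (rule derivable.impE)
  then have "\<langle>r \<cdot> a\<rangle> = \<langle>r \<cdot> ?b\<rangle>"
    by (rule val_eqI_derivable) simp_all
  then show ?thesis by (simp add: val_App)
qed

text \<open>Both sides unfold to \<open>x * u * \<epsilon>\<^sub>s\<^sub>*\<^sub>x\<^sub>*\<^sub>u\<close> of a function, so it suffices to compare the two functions.\<close>
lemma lhs_eq_rhsI:
  assumes G: "inst 0 G (MBR'_eq (X, R)) \<in> H" "tyof \<Gamma> G = Some (bar_rec_type (X, R))"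
    and "tyof \<Gamma> s = Some (Seq X)" "tyof \<Gamma> \<epsilon> = Some (Sel X R)" "tyof \<Gamma> q = Some (Stream X \<rightarrow> R)"
    and "tyof \<Gamma> x = Some X" "tyof \<Gamma> u = Some (Seq X)"
    and body: "ctx.val (X # \<Gamma>) (lift ` H) (ren Suc q \<cdot> lhs_tm X R (ren Suc G) (ren Suc s) (ren Suc \<epsilon>)
        (ren Suc q) (ren Suc x) (Con (Snoc X) \<cdot> ren Suc u \<cdot> Var 0)) =
      ctx.val (X # \<Gamma>) (lift ` H) (ren Suc q \<cdot> rhs_tm X R (ren Suc G) (ren Suc s) (ren Suc \<epsilon>)
        (ren Suc q) (ren Suc x) (Con (Snoc X) \<cdot> ren Suc u \<cdot> Var 0))"
  shows "\<langle>lhs_tm X R G s \<epsilon> q x u\<rangle> = \<langle>rhs_tm X R G s \<epsilon> q x u\<rangle>"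
proof -
  note [simp] = assms(2-7)
  let ?xu = "concat_tm X \<cdot> (Con (Snoc X) \<cdot> Con (Empty X) \<cdot> x) \<cdot> u"
  let ?e = "shift_tm X R \<cdot> \<epsilon> \<cdot> s"
  let ?b = "ren Suc q \<cdot> (ren Suc G \<cdot> (Con (Snoc X) \<cdot> ren Suc ?xu \<cdot> Var 0) \<cdot> ren Suc ?e \<cdot> ren Suc q)"
  let ?e' = "shift_tm X R \<cdot> \<epsilon> \<cdot> (Con (Snoc X) \<cdot> s \<cdot> x)"
  let ?q' = "section_tm X R \<cdot> q \<cdot> x"
  let ?b' = "ren Suc ?q' \<cdot> (ren Suc G \<cdot> (Con (Snoc X) \<cdot> ren Suc u \<cdot> Var 0) \<cdot> ren Suc ?e' \<cdot> ren Suc ?q')"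
  \<comment> \<open>\<open>K\<close> is the common class of the two functions handed to the
    selection; naming it lets both unfoldings end in the same application.\<close>
  define K where "K = \<langle>Lam X ?b\<rangle>"
  have K: "K = \<langle>Lam X ?b'\<rangle>"
    unfolding K_def
  proof (rule val_Lam)
    show "ctx.val (X # \<Gamma>) (lift ` H) ?b = ctx.val (X # \<Gamma>) (lift ` H) ?b'"
      using body by (simp add: lhs_tm_def rhs_tm_def val_simps bar_rec_type_def)
    show "tyof (X # \<Gamma>) ?b = Some R" by (simp add: bar_rec_type_def)
  qed
  have "\<langle>G \<cdot> ?xu \<cdot> ?e \<cdot> q\<rangle> = \<langle>append_tm X \<cdot> ?xu\<rangle> \<bullet> (\<langle>?e \<cdot> ?xu\<rangle> \<bullet> K)"
    unfolding K_def val_App[symmetric] by (rule val_MBR') (simp_all add: G)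
  moreover have "\<langle>G \<cdot> u \<cdot> ?e' \<cdot> ?q'\<rangle> = \<langle>append_tm X \<cdot> u\<rangle> \<bullet> (\<langle>?e' \<cdot> u\<rangle> \<bullet> K)"
    unfolding K val_App[symmetric] by (rule val_MBR') (simp_all add: G)
  moreover have "vty K = Some (X \<rightarrow> R)"
    by (simp add: K_def vty_val bar_rec_type_def)
  ultimately show ?thesis
    by (simp add: lhs_tm_def rhs_tm_def val_simps append_concat concat_concat_singleton)
qed

text \<open>The outermost operation in the equation is to prepend \<open>s\<close>. Only this much
  about the value is kept, since continuity looks at nothing beyond the prefix.\<close>

lemma MBR'_extends:
  assumes "inst 0 G (MBR'_eq (X, R)) \<in> H" "tyof \<Gamma> G = Some (bar_rec_type (X, R))"
    and "tyof \<Gamma> s = Some (Seq X)" "tyof \<Gamma> \<epsilon> = Some (Sel X R)" "tyof \<Gamma> q = Some (Stream X \<rightarrow> R)"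
  shows "\<exists>w. tyof \<Gamma> w = Some (Stream X) \<and> \<langle>G \<cdot> s \<cdot> \<epsilon> \<cdot> q\<rangle> = \<langle>append_tm X \<cdot> s \<cdot> w\<rangle>"
  using val_MBR'[OF assms] assms(2-)
  by (intro HOL.exI[of _ "\<epsilon> \<cdot> s \<cdot> Lam X (ren Suc q
    \<cdot> (ren Suc G \<cdot> (Con (Snoc X) \<cdot> ren Suc s \<cdot> Var 0) \<cdot> ren Suc \<epsilon> \<cdot> ren Suc q))"])
    (simp add: bar_rec_type_def)

end

section \<open>Bar induction with continuity\<close>

lemma lift_image_mem: "A \<in> H \<Longrightarrow> lift A \<in> lift ` H"
  by (rule imageI)

text \<open>The general identity in \<open>u\<close> is proved by bar induction with
  \<open>Q\<close> as predicate. Its instance at the empty sequence is what the equation of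
  \<open>MBR\<close> requires.\<close>

lemma (in ctx) MBR'_prefix:
  assumes R: "discrete_type R"
    and G: "inst 0 G (MBR'_eq (X, R)) \<in> H" "tyof \<Gamma> G = Some (bar_rec_type (X, R))"
    and "tyof \<Gamma> s = Some (Seq X)" "tyof \<Gamma> \<epsilon> = Some (Sel X R)" "tyof \<Gamma> q = Some (Stream X \<rightarrow> R)"
    and "tyof \<Gamma> x = Some X"
  shows "\<langle>lhs_tm X R G s \<epsilon> q x (Con (Empty X))\<rangle> = \<langle>rhs_tm X R G s \<epsilon> q x (Con (Empty X))\<rangle>"
proof -
  note [simp] = assms(3-)
  have ty_lhs: "tyof \<Delta> (lhs_tm X R g t e f y u) = Some (Stream X)" (is ?l)
    and ty_rhs: "tyof \<Delta> (rhs_tm X R g t e f y u) = Some (Stream X)" (is ?r)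
    if "tyof \<Delta> g = Some (bar_rec_type (X, R))" "tyof \<Delta> t = Some (Seq X)" "tyof \<Delta> e = Some (Sel X R)"
      "tyof \<Delta> f = Some (Stream X \<rightarrow> R)" "tyof \<Delta> y = Some X" "tyof \<Delta> u = Some (Seq X)" for \<Delta> g t e f y u
    using that by (simp_all add: lhs_tm_def rhs_tm_def bar_rec_type_def)
  \<comment> \<open>The trivially true relativising predicate admits every sequence, so this is
    plain bar induction.\<close>
  let ?P = "Eq Nat (Con Zero) (Con Zero)"
  define Q where "Q = Eq (Stream X)
    (lhs_tm X R (ren Suc G) (ren Suc s) (ren Suc \<epsilon>) (ren Suc q) (ren Suc x) (Var 0))
    (rhs_tm X R (ren Suc G) (ren Suc s) (ren Suc \<epsilon>) (ren Suc q) (ren Suc x) (Var 0))"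
  have wff_Q: "wff (Seq X # \<Gamma>) Q"
    by (simp add: Q_def has_type_iff ty_lhs ty_rhs)
  have P: "derivable Th \<Delta> K ?P" for \<Delta> K
    by (rule ctx.derivable_EqI) simp_all
  have inst_P [simp]: "inst k t ?P = ?P" for k t
    by (simp add: inst_def)
  have "derivable Th \<Gamma> H (bi_fm X ?P Q)"
  proof (rule derivable.ax)
    show "(\<Gamma>, bi_fm X ?P Q) \<in> Th" by (auto simp: BI_def)
    show "wff \<Gamma> (bi_fm X ?P Q)"
      using wff_Q by (auto simp: bi_fm_def has_type_iff intro!: wff_inst_0 wff_inst_2)
  qed
  moreover have "derivable Th \<Gamma> H (All (Stream X) (All Nat ?P \<^bold>\<longrightarrow> Ex Nat (inst 2 (prefix_tm X \<cdot> Var 1 \<cdot> Var 0) Q)))"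
  proof (intro derivable.allI derivable.impI)
    let ?\<Gamma> = "Stream X # \<Gamma>" and ?H = "insert (All Nat ?P) (lift ` H)"
    \<comment> \<open>Continuity is applied to \<open>q_x\<close>, because the common initial
      \<open>x\<close> of both sides is split off first.\<close>
    let ?r = "section_tm X R \<cdot> ren Suc q \<cdot> ren Suc x"
    let ?C = "All (Stream X)
      (Eq (Seq X) (prefix_tm X \<cdot> Var 2 \<cdot> Var 1) (prefix_tm X \<cdot> Var 0 \<cdot> Var 1) \<^bold>\<longrightarrow>
       Eq R (ren Suc (ren Suc ?r) \<cdot> Var 2) (ren Suc (ren Suc ?r) \<cdot> Var 0))"
    show "wff ?\<Gamma> (All Nat ?P)" by (simp add: has_type_iff)
    have "derivable Th ?\<Gamma> ?H (cont_fm X R)"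
      by (rule derivable.ax) (use R in \<open>auto simp: CONT_def cont_fm_def has_type_iff\<close>)
    from derivable.allE[OF this[unfolded cont_fm_def], of ?r]
    have "derivable Th ?\<Gamma> ?H (All (Stream X) (Ex Nat (All (Stream X)
      (Eq (Seq X) (prefix_tm X \<cdot> Var 2 \<cdot> Var 1) (prefix_tm X \<cdot> Var 0 \<cdot> Var 1) \<^bold>\<longrightarrow>
       Eq R (ren Suc (ren Suc (ren Suc ?r)) \<cdot> Var 2) (ren Suc (ren Suc (ren Suc ?r)) \<cdot> Var 0)))))"
      by (simp add: has_type_iff inst_def eval_nat_numeral)
    from derivable.allE[OF this, of "Var 0"]
    have "derivable Th ?\<Gamma> ?H (Ex Nat ?C)"
      by (simp add: has_type_iff inst_def eval_nat_numeral)
    then show "derivable Th ?\<Gamma> ?H (Ex Nat (inst 2 (prefix_tm X \<cdot> Var 1 \<cdot> Var 0) Q))"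
    proof (rule derivable.exE)
      let ?\<Gamma>' = "Nat # ?\<Gamma>" and ?H' = "insert ?C (lift ` ?H)"
      let ?G = "ren Suc (ren Suc G)" and ?s = "ren Suc (ren Suc s)" and ?e = "ren Suc (ren Suc \<epsilon>)"
        and ?q = "ren Suc (ren Suc q)" and ?x = "ren Suc (ren Suc x)"
      \<comment> \<open>With \<alpha> at index 1 and the modulus \<open>n\<close> of
        \<open>q_x\<close> at index 0, the bar is hit at \<open>[\<alpha>](n)\<close>.\<close>
      let ?u = "prefix_tm X \<cdot> Var 1 \<cdot> Var 0"
      interpret c: ctx "X # ?\<Gamma>'" "lift ` ?H'" .
      have "inst 0 ?G (MBR'_eq (X, R)) \<in> lift ` lift ` H"
        using lift_image_mem[OF lift_image_mem[OF G(1)]] by (simp add: lift_inst_MBR'_eq)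
      then have G': "inst 0 ?G (MBR'_eq (X, R)) \<in> ?H'" by auto
      then have G'': "inst 0 (ren Suc ?G) (MBR'_eq (X, R)) \<in> lift ` ?H'"
        using lift_image_mem by (metis lift_inst_MBR'_eq)
      have C: "lift ?C \<in> lift ` ?H'" by (intro lift_image_mem insertI1)
      \<comment> \<open>\<open>q_x\<close> is constant on the extensions of
        \<open>[\<alpha>](n)\<close>. Here one more entry has been introduced, so \<alpha> is index
        2 and \<open>n\<close> is index 1.\<close>
      have cont: "c.val (section_tm X R \<cdot> ren Suc ?q \<cdot> ren Suc ?x \<cdot> (append_tm X \<cdot> ren Suc ?u \<cdot> b)) =
          c.val (section_tm X R \<cdot> ren Suc ?q \<cdot> ren Suc ?x \<cdot> Var 2)"
        if "tyof (X # ?\<Gamma>') b = Some (Stream X)" for b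
        using c.cont_append_prefix[of X "Var 2" "Var 1" R "section_tm X R \<cdot> ren Suc ?q \<cdot> ren Suc ?x" "c.val b"] C that
        by (simp add: ctx.val_App ctx.vty_val ctx.vty_ap eval_nat_numeral)
      have "ctx.val ?\<Gamma>' ?H' (lhs_tm X R ?G ?s ?e ?q ?x ?u) = ctx.val ?\<Gamma>' ?H' (rhs_tm X R ?G ?s ?e ?q ?x ?u)"
      proof (rule ctx.lhs_eq_rhsI)
        let ?y = "Con (Snoc X) \<cdot> ren Suc ?u \<cdot> Var 0"
        \<comment> \<open>Both recursive values extend known finite sequences: the left one is
          \<open>x * u * y * v\<close> and the value of \<open>G\<close> on the right is
          \<open>u * y * w\<close>, with \<open>y\<close> the new entry and unknown tails
          \<open>v\<close> and \<open>w\<close>.\<close>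
        have "\<exists>v. tyof (X # ?\<Gamma>') v = Some (Stream X) \<and>
          c.val (lhs_tm X R (ren Suc ?G) (ren Suc ?s) (ren Suc ?e) (ren Suc ?q) (ren Suc ?x) ?y) =
          c.val (append_tm X \<cdot> (concat_tm X \<cdot> (Con (Snoc X) \<cdot> Con (Empty X) \<cdot> ren Suc ?x) \<cdot> ?y) \<cdot> v)"
          unfolding lhs_tm_def by (rule c.MBR'_extends[OF G'']) simp_all
        then obtain v where v: "tyof (X # ?\<Gamma>') v = Some (Stream X)"
          "c.val (lhs_tm X R (ren Suc ?G) (ren Suc ?s) (ren Suc ?e) (ren Suc ?q) (ren Suc ?x) ?y) =
           c.val (append_tm X \<cdot> (concat_tm X \<cdot> (Con (Snoc X) \<cdot> Con (Empty X) \<cdot> ren Suc ?x) \<cdot> ?y) \<cdot> v)"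
          by blast
        have "\<exists>w. tyof (X # ?\<Gamma>') w = Some (Stream X) \<and>
          c.val (ren Suc ?G \<cdot> ?y \<cdot> (shift_tm X R \<cdot> ren Suc ?e \<cdot> (Con (Snoc X) \<cdot> ren Suc ?s \<cdot> ren Suc ?x)) \<cdot> (section_tm X R \<cdot> ren Suc ?q \<cdot> ren Suc ?x)) =
          c.val (append_tm X \<cdot> ?y \<cdot> w)"
          by (rule c.MBR'_extends[OF G'']) simp_all
        then obtain w where w: "tyof (X # ?\<Gamma>') w = Some (Stream X)"
          "c.val (ren Suc ?G \<cdot> ?y \<cdot> (shift_tm X R \<cdot> ren Suc ?e \<cdot> (Con (Snoc X) \<cdot> ren Suc ?s \<cdot> ren Suc ?x)) \<cdot> (section_tm X R \<cdot> ren Suc ?q \<cdot> ren Suc ?x)) =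
           c.val (append_tm X \<cdot> ?y \<cdot> w)"
          by blast
        \<comment> \<open>Only the outer application is split, so that the equation for
          \<open>v\<close> matches the whole argument; afterwards \<open>x\<close> is absorbed into
          \<open>q_x\<close>.\<close>
        have "c.val (ren Suc ?q \<cdot> lhs_tm X R (ren Suc ?G) (ren Suc ?s) (ren Suc ?e) (ren Suc ?q) (ren Suc ?x) ?y) =
            c.val (section_tm X R \<cdot> ren Suc ?q \<cdot> ren Suc ?x \<cdot> (append_tm X \<cdot> ren Suc ?u \<cdot> (cons_tm X \<cdot> Var 0 \<cdot> v)))"
          using v(1) unfolding c.val_App[of "ren Suc ?q"] v(2)
          by (simp add: val_simps ctx.append_concat eval_nat_numeral)
        \<comment> \<open>The tails do not matter: both values equal
          \<open>q_x(\<alpha>)\<close>.\<close>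
        also have "\<dots> = c.val (section_tm X R \<cdot> ren Suc ?q \<cdot> ren Suc ?x \<cdot> (append_tm X \<cdot> ren Suc ?u \<cdot> (cons_tm X \<cdot> Var 0 \<cdot> w)))"
          using cont[of "cons_tm X \<cdot> Var 0 \<cdot> v"] cont[of "cons_tm X \<cdot> Var 0 \<cdot> w"] v(1) w(1) by simp
        also have "\<dots> = c.val (ren Suc ?q \<cdot> rhs_tm X R (ren Suc ?G) (ren Suc ?s) (ren Suc ?e) (ren Suc ?q) (ren Suc ?x) ?y)"
          using w(1) unfolding c.val_App[of "ren Suc ?q"] rhs_tm_def c.val_App[of "cons_tm X \<cdot> ren Suc ?x"] w(2)
          by (simp add: val_simps eval_nat_numeral)
        finally show "c.val (ren Suc ?q \<cdot> lhs_tm X R (ren Suc ?G) (ren Suc ?s) (ren Suc ?e) (ren Suc ?q) (ren Suc ?x) ?y) =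
            c.val (ren Suc ?q \<cdot> rhs_tm X R (ren Suc ?G) (ren Suc ?s) (ren Suc ?e) (ren Suc ?q) (ren Suc ?x) ?y)" .
      qed (use G' in simp_all)
      then have "derivable Th ?\<Gamma>' ?H' (Eq (Stream X) (lhs_tm X R ?G ?s ?e ?q ?x ?u) (rhs_tm X R ?G ?s ?e ?q ?x ?u))"
        by (rule ctx.derivable_EqI) (rule ty_lhs; simp)
      \<comment> \<open>The modulus \<open>n\<close> itself witnesses the existential
        quantifier.\<close>
      then show "derivable Th ?\<Gamma>' ?H' (lift (Ex Nat (inst 2 (prefix_tm X \<cdot> Var 1 \<cdot> Var 0) Q)))"
        unfolding fsub.simps
        by (intro derivable.exI[where t = "Var 0"])
          (simp_all add: Q_def inst_def has_type_iff ty_lhs ty_rhs eval_nat_numeral)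
    qed
  qed
  moreover have "derivable Th \<Gamma> H (All (Seq X) (?P \<^bold>\<longrightarrow>
      All X (?P \<^bold>\<longrightarrow> inst 2 (Con (Snoc X) \<cdot> Var 1 \<cdot> Var 0) Q) \<^bold>\<longrightarrow> Q))"
  proof (intro derivable.allI derivable.impI)
    let ?I = "All X (?P \<^bold>\<longrightarrow> inst 2 (Con (Snoc X) \<cdot> Var 1 \<cdot> Var 0) Q)"
    let ?\<Gamma> = "Seq X # \<Gamma>" and ?H = "insert ?I (insert ?P (lift ` H))"
    show "wff ?\<Gamma> ?P" by (simp add: has_type_iff)
    show wff_I: "wff ?\<Gamma> ?I"
      using wff_Q by (auto simp: has_type_iff intro!: wff_inst_2)
    have "lift ?I \<in> lift ` ?H" by (intro lift_image_mem insertI1)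
    then have "derivable Th (X # ?\<Gamma>) (lift ` ?H) (lift ?I)"
      by (rule derivable.hyp) (rule wff_fsub[OF wff_I], simp)
    from derivable.allE[OF this[unfolded fsub.simps], of "Var 0"]
    have "derivable Th (X # ?\<Gamma>) (lift ` ?H) (?P \<^bold>\<longrightarrow> Eq (Stream X)
      (lhs_tm X R (ren Suc (ren Suc G)) (ren Suc (ren Suc s)) (ren Suc (ren Suc \<epsilon>)) (ren Suc (ren Suc q)) (ren Suc (ren Suc x)) (Con (Snoc X) \<cdot> Var 1 \<cdot> Var 0))
      (rhs_tm X R (ren Suc (ren Suc G)) (ren Suc (ren Suc s)) (ren Suc (ren Suc \<epsilon>)) (ren Suc (ren Suc q)) (ren Suc (ren Suc x)) (Con (Snoc X) \<cdot> Var 1 \<cdot> Var 0)))"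
      by (simp add: Q_def inst_def has_type_iff)
    from derivable.impE[OF this P]
    have IH: "ctx.val (X # ?\<Gamma>) (lift ` ?H)
      (lhs_tm X R (ren Suc (ren Suc G)) (ren Suc (ren Suc s)) (ren Suc (ren Suc \<epsilon>)) (ren Suc (ren Suc q)) (ren Suc (ren Suc x)) (Con (Snoc X) \<cdot> Var 1 \<cdot> Var 0)) =
      ctx.val (X # ?\<Gamma>) (lift ` ?H)
      (rhs_tm X R (ren Suc (ren Suc G)) (ren Suc (ren Suc s)) (ren Suc (ren Suc \<epsilon>)) (ren Suc (ren Suc q)) (ren Suc (ren Suc x)) (Con (Snoc X) \<cdot> Var 1 \<cdot> Var 0))"
      by (rule ctx.val_eqI_derivable) (rule ty_lhs ty_rhs; simp)+
    have G': "inst 0 (ren Suc G) (MBR'_eq (X, R)) \<in> ?H"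
      using lift_image_mem[OF G(1)] by (simp add: lift_inst_MBR'_eq)
    \<comment> \<open>Equality at every one-entry extension of \<open>u\<close>, after applying
      \<open>q\<close>, is exactly the agreement of functions demanded by
      \<open>lhs_eq_rhsI\<close>.\<close>
    have "ctx.val ?\<Gamma> ?H (lhs_tm X R (ren Suc G) (ren Suc s) (ren Suc \<epsilon>) (ren Suc q) (ren Suc x) (Var 0)) =
        ctx.val ?\<Gamma> ?H (rhs_tm X R (ren Suc G) (ren Suc s) (ren Suc \<epsilon>) (ren Suc q) (ren Suc x) (Var 0))"
      by (rule ctx.lhs_eq_rhsI[OF G']) (use IH in \<open>simp_all add: ctx.val_App[of _ _ "ren Suc (ren Suc q)"]\<close>)
    then have "derivable Th ?\<Gamma> ?H (Eq (Stream X)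
        (lhs_tm X R (ren Suc G) (ren Suc s) (ren Suc \<epsilon>) (ren Suc q) (ren Suc x) (Var 0))
        (rhs_tm X R (ren Suc G) (ren Suc s) (ren Suc \<epsilon>) (ren Suc q) (ren Suc x) (Var 0)))"
      by (rule ctx.derivable_EqI) (rule ty_lhs; simp)
    then show "derivable Th ?\<Gamma> ?H Q" by (simp only: Q_def)
  qed
  ultimately have "derivable Th \<Gamma> H (inst 0 (Con (Empty X)) Q)"
    using P[of \<Gamma> H] unfolding bi_fm_def inst_P by (blast intro: derivable.impE)
  then have "derivable Th \<Gamma> H (Eq (Stream X) (lhs_tm X R G s \<epsilon> q x (Con (Empty X))) (rhs_tm X R G s \<epsilon> q x (Con (Empty X))))"
    by (simp add: Q_def inst_def)
  then show ?thesis
    by (rule val_eqI_derivable) (rule ty_lhs ty_rhs; simp)+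
qed

text \<open>\<open>G\<close> is unfolded once at the empty sequence. Under the binder,
  \<open>MBR'_prefix\<close> turns the recursive value at the singleton of \<open>x\<close> into
  \<open>x * F_{s*x}(\<epsilon>)(q_x)\<close>, and applying \<open>q\<close> to it yields
  \<open>q_x(F_{s*x}(\<epsilon>)(q_x))\<close>.\<close>

lemma (in ctx) val_MBR_of_MBR':
  assumes R: "discrete_type R"
    and G: "inst 0 G (MBR'_eq (X, R)) \<in> H" "tyof \<Gamma> G = Some (bar_rec_type (X, R))"
    and "tyof \<Gamma> s = Some (Seq X)" "tyof \<Gamma> \<epsilon> = Some (Sel X R)" "tyof \<Gamma> q = Some (Stream X \<rightarrow> R)"
  defines "F \<equiv> MBR_of_MBR' X R \<cdot> G"
  shows "\<langle>F \<cdot> s \<cdot> \<epsilon> \<cdot> q\<rangle> = \<langle>\<epsilon> \<cdot> s \<cdot> Lam X (section_tm X R \<cdot> ren Suc q \<cdot> Var 0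
    \<cdot> (ren Suc F \<cdot> (Con (Snoc X) \<cdot> ren Suc s \<cdot> Var 0) \<cdot> ren Suc \<epsilon> \<cdot> (section_tm X R \<cdot> ren Suc q \<cdot> Var 0)))\<rangle>"
proof -
  note [simp] = assms(3-6)
  let ?e = "shift_tm X R \<cdot> \<epsilon> \<cdot> s"
  let ?b = "ren Suc q \<cdot> (ren Suc G \<cdot> (Con (Snoc X) \<cdot> ren Suc (Con (Empty X)) \<cdot> Var 0) \<cdot> ren Suc ?e \<cdot> ren Suc q)"
  let ?b' = "section_tm X R \<cdot> ren Suc q \<cdot> Var 0
    \<cdot> (ren Suc F \<cdot> (Con (Snoc X) \<cdot> ren Suc s \<cdot> Var 0) \<cdot> ren Suc \<epsilon> \<cdot> (section_tm X R \<cdot> ren Suc q \<cdot> Var 0))"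
  define K where "K = \<langle>Lam X ?b\<rangle>"
  have K: "K = \<langle>Lam X ?b'\<rangle>"
    unfolding K_def
  proof (rule val_Lam)
    have "inst 0 (ren Suc G) (MBR'_eq (X, R)) \<in> lift ` H"
      using lift_image_mem[OF G(1)] by (simp add: lift_inst_MBR'_eq)
    \<comment> \<open>The identity is used in the extended context, with the bound variable as the
      entry \<open>x\<close>.\<close>
    from ctx.MBR'_prefix[OF R this, of "X # \<Gamma>" "ren Suc s" "ren Suc \<epsilon>" "ren Suc q" "Var 0"]
    show "ctx.val (X # \<Gamma>) (lift ` H) ?b = ctx.val (X # \<Gamma>) (lift ` H) ?b'"
      by (simp add: F_def lhs_tm_def rhs_tm_def val_simps ctx.ap_MBR_of_MBR' bar_rec_type_def)
    show "tyof (X # \<Gamma>) ?b = Some R" by (simp add: bar_rec_type_def)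
  qed
  have "\<langle>G \<cdot> Con (Empty X) \<cdot> ?e \<cdot> q\<rangle> = \<langle>append_tm X \<cdot> Con (Empty X)\<rangle> \<bullet> (\<langle>?e \<cdot> Con (Empty X)\<rangle> \<bullet> K)"
    unfolding K_def val_App[symmetric] by (rule val_MBR') (simp_all add: G)
  moreover have "vty K = Some (X \<rightarrow> R)"
    by (simp add: K_def vty_val bar_rec_type_def)
  ultimately have "\<langle>F \<cdot> s \<cdot> \<epsilon> \<cdot> q\<rangle> = \<langle>\<epsilon> \<cdot> s\<rangle> \<bullet> K"
    by (simp add: F_def val_simps ap_MBR_of_MBR')
  then show ?thesis unfolding K val_App .
qed

lemma derivable_MBR_of_MBR':
  assumes "discrete_type R"
  shows "derivable Th [bar_rec_type (X, R)] {MBR'_eq (X, R)} (inst 1 (MBR_of_MBR' X R \<cdot> Var 0) (MBR_eq (X, R)))"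
proof -
  let ?\<Gamma> = "[Stream X \<rightarrow> R, Sel X R, Seq X, bar_rec_type (X, R)]"
  let ?H = "lift ` lift ` lift ` {MBR'_eq (X, R)}"
  have "MBR'_eq (X, R) = inst 0 (Var 0) (MBR'_eq (X, R))"
    by (simp add: MBR'_eq_def inst_def)
  then have "?H = {inst 0 (Var 3) (MBR'_eq (X, R))}"
    by (metis (no_types, lifting) image_empty image_insert lift_inst_MBR'_eq ren.simps(1) numeral_3_eq_3)
  then have "inst 0 (Var 3) (MBR'_eq (X, R)) \<in> ?H" by simp
  from ctx.val_MBR_of_MBR'[OF assms this, of ?\<Gamma> "Var 2" "Var 1" "Var 0"] show ?thesis
    by (auto simp: inst_def MBR_eq_def bar_rec_type_def eval_nat_numeral intro!: derivable.allI ctx.derivable_EqI)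
qed

theorem theorem4p10:
  shows "T_defines (HA_omega \<union> BI \<union> CONT) MBR MBR' \<and>
         T_defines (HA_omega \<union> BI \<union> CONT) MBR' MBR"
proof
  \<comment> \<open>In both directions the type parameters \<open>(X, R)\<close> are kept, and the
    defining term is closed.\<close>
  show "T_defines Th MBR MBR'"
    unfolding T_defines_def
  proof
    fix p assume "p \<in> choices MBR'"
    then obtain X R where "p = (X, R)" "discrete_type R" by (auto simp: MBR'_def)
    then show "\<exists>f\<in>choices MBR. \<exists>s. [] \<turnstile> s \<Colon> fun_type MBR f \<rightarrow> fun_type MBR' p \<and>
        derivable Th [fun_type MBR f] {def_eq MBR f} (inst 1 (s \<cdot> Var 0) (def_eq MBR' p))"
      using derivable_MBR'_of_MBR[of X R]
      by (intro bexI[of _ p] HOL.exI[of _ "MBR'_of_MBR X R"])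
        (simp_all add: MBR_def MBR'_def has_type_iff)
  qed
  show "T_defines Th MBR' MBR"
    unfolding T_defines_def
  proof
    fix p assume "p \<in> choices MBR"
    then obtain X R where "p = (X, R)" "discrete_type R" by (auto simp: MBR_def)
    then show "\<exists>f\<in>choices MBR'. \<exists>s. [] \<turnstile> s \<Colon> fun_type MBR' f \<rightarrow> fun_type MBR p \<and>
        derivable Th [fun_type MBR' f] {def_eq MBR' f} (inst 1 (s \<cdot> Var 0) (def_eq MBR p))"
      using derivable_MBR_of_MBR'[of R X]
      by (intro bexI[of _ p] HOL.exI[of _ "MBR_of_MBR' X R"])
        (simp_all add: MBR_def MBR'_def has_type_iff)
  qed
qed

end
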